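(* Let $\mathbf{A}$ and $\mathbf{A}'$ be finite skeletal categories containing no nontrivial endomorphisms. If they have the same underlying directed graph then $\chi(|N\mathbf{A}|)=\chi(|N\mathbf{A}'|)$.
   Context: A category is finite if it has only finitely many objects and maps; it is skeletal if isomorphic objects are equal; it contains no nontrivial endomorphisms if every map with equal source and target is an identity. The underlying directed graph of a category consists of its objects (vertices) and maps (edges) with their sources and targets, forgetting composition and identities. $N\mathbf{A}$ is the simplicial nerve of $\mathbf{A}$, $|N\mathbf{A}|$ its geometric realization (the classifying space of $\mathbf{A}$), and $\chi$ of a space is the usual topological Euler characteristic. *)

theory Defs
  imports "HOL-Homology.Homology" "Graph_Theory.Digraph_Isomorphism"
begin

section \<open>Categories\<close>

text \<open>\<open>Comp C g f\<close> is the composite of \<open>f\<close> followed by \<open>g\<close>; all operations are only meaningful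
  on the carriers \<open>Obj C\<close> and \<open>Mor C\<close>.\<close>

record ('o, 'm) cat =
  Obj :: "'o set"
  Mor :: "'m set"
  Dom :: "'m \<Rightarrow> 'o"
  Cod :: "'m \<Rightarrow> 'o"
  Id :: "'o \<Rightarrow> 'm"
  Comp :: "'m \<Rightarrow> 'm \<Rightarrow> 'm"

locale category =
  fixes C :: "('o, 'm) cat"
  assumes Dom_closed: "f \<in> Mor C \<Longrightarrow> Dom C f \<in> Obj C"
    and Cod_closed: "f \<in> Mor C \<Longrightarrow> Cod C f \<in> Obj C"
    and Id_closed: "a \<in> Obj C \<Longrightarrow> Id C a \<in> Mor C"
    and Dom_Id: "a \<in> Obj C \<Longrightarrow> Dom C (Id C a) = a"
    and Cod_Id: "a \<in> Obj C \<Longrightarrow> Cod C (Id C a) = a"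
    and Comp_closed:
      "\<lbrakk>f \<in> Mor C; g \<in> Mor C; Cod C f = Dom C g\<rbrakk> \<Longrightarrow> Comp C g f \<in> Mor C"
    and Dom_Comp:
      "\<lbrakk>f \<in> Mor C; g \<in> Mor C; Cod C f = Dom C g\<rbrakk> \<Longrightarrow> Dom C (Comp C g f) = Dom C f"
    and Cod_Comp:
      "\<lbrakk>f \<in> Mor C; g \<in> Mor C; Cod C f = Dom C g\<rbrakk> \<Longrightarrow> Cod C (Comp C g f) = Cod C g"
    and Comp_Id_right: "f \<in> Mor C \<Longrightarrow> Comp C f (Id C (Dom C f)) = f"
    and Comp_Id_left: "f \<in> Mor C \<Longrightarrow> Comp C (Id C (Cod C f)) f = f"
    and Comp_assoc:
      "\<lbrakk>f \<in> Mor C; g \<in> Mor C; h \<in> Mor C; Cod C f = Dom C g; Cod C g = Dom C h\<rbrakk>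
        \<Longrightarrow> Comp C h (Comp C g f) = Comp C (Comp C h g) f"

definition finite_cat :: "('o, 'm) cat \<Rightarrow> bool" where
  "finite_cat C \<longleftrightarrow> finite (Obj C) \<and> finite (Mor C)"

definition isomorphic_in :: "('o, 'm) cat \<Rightarrow> 'o \<Rightarrow> 'o \<Rightarrow> bool" where
  "isomorphic_in C a b \<longleftrightarrow>
    (\<exists>f \<in> Mor C. \<exists>g \<in> Mor C. Dom C f = a \<and> Cod C f = b \<and> Dom C g = b \<and> Cod C g = a \<and>
      Comp C g f = Id C a \<and> Comp C f g = Id C b)"

definition skeletal :: "('o, 'm) cat \<Rightarrow> bool" where
  "skeletal C \<longleftrightarrow> (\<forall>a \<in> Obj C. \<forall>b \<in> Obj C. isomorphic_in C a b \<longrightarrow> a = b)"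

definition no_nontrivial_endomorphisms :: "('o, 'm) cat \<Rightarrow> bool" where
  "no_nontrivial_endomorphisms C \<longleftrightarrow>
    (\<forall>f \<in> Mor C. Dom C f = Cod C f \<longrightarrow> f = Id C (Dom C f))"

text \<open>Every map, identities included, is an arc.\<close>

definition underlying_digraph :: "('o, 'm) cat \<Rightarrow> ('o, 'm) pre_digraph" where
  "underlying_digraph C = \<lparr>verts = Obj C, arcs = Mor C, tail = Dom C, head = Cod C\<rparr>"

lemma (in category) wf_underlying_digraph: "wf_digraph (underlying_digraph C)"
  by unfold_locales (simp_all add: underlying_digraph_def Dom_closed Cod_closed)

lemma (in category) digraph_iso_underlying_if_same:
  assumes "Obj D = Obj C" "Mor D = Mor C"
    and "\<And>f. f \<in> Mor C \<Longrightarrow> Dom D f = Dom C f" "\<And>f. f \<in> Mor C \<Longrightarrow> Cod D f = Cod C f"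
  shows "digraph_iso (underlying_digraph C) (underlying_digraph D)"
proof -
  let ?h = "\<lparr>iso_verts = id, iso_arcs = id, iso_head = Cod D, iso_tail = Dom D\<rparr>"
  have "pre_digraph.digraph_isomorphism (underlying_digraph C) ?h"
    using assms wf_underlying_digraph
    by (simp add: pre_digraph.digraph_isomorphism_def underlying_digraph_def)
  moreover have "underlying_digraph D = app_iso ?h (underlying_digraph C)"
    using assms by (simp add: app_iso_def underlying_digraph_def)
  ultimately show ?thesis
    unfolding digraph_iso_def by blast
qed

text \<open>A functor is a pair of its object map and its arrow map, both extensional, so that equality
  of pairs is equality of functors.\<close>

definition functors ::
    "('o, 'm) cat \<Rightarrow> ('p, 'q) cat \<Rightarrow> (('o \<Rightarrow> 'p) \<times> ('m \<Rightarrow> 'q)) set" where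
  "functors C D =
    {(F, G). F \<in> Obj C \<rightarrow>\<^sub>E Obj D \<and> G \<in> Mor C \<rightarrow>\<^sub>E Mor D \<and>
      (\<forall>f \<in> Mor C. Dom D (G f) = F (Dom C f) \<and> Cod D (G f) = F (Cod C f)) \<and>
      (\<forall>a \<in> Obj C. G (Id C a) = Id D (F a)) \<and>
      (\<forall>f \<in> Mor C. \<forall>g \<in> Mor C. Cod C f = Dom C g \<longrightarrow> G (Comp C g f) = Comp D (G g) (G f))}"


section \<open>Simplicial sets\<close>

text \<open>The ordinal \<open>[n] = {0 < \<dots> < n}\<close> as a category; the arrow \<open>i \<le> j\<close> is the pair \<open>(i, j)\<close>.\<close>

definition ordinal_cat :: "nat \<Rightarrow> (nat, nat \<times> nat) cat" where
  "ordinal_cat n =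
    \<lparr>Obj = {..n}, Mor = {(i, j). i \<le> j \<and> j \<le> n}, Dom = fst, Cod = snd,
     Id = (\<lambda>i. (i, i)), Comp = (\<lambda>g f. (fst f, snd g))\<rparr>"

lemma category_ordinal_cat: "category (ordinal_cat n)"
  by unfold_locales (auto simp: ordinal_cat_def)

text \<open>The order-preserving maps \<open>[m] \<rightarrow> [n]\<close>.\<close>

definition simplex_maps :: "nat \<Rightarrow> nat \<Rightarrow> (nat \<Rightarrow> nat) set" where
  "simplex_maps m n = {\<theta> \<in> {..m} \<rightarrow>\<^sub>E {..n}. mono_on {..m} \<theta>}"

text \<open>For \<open>\<theta> : [m] \<rightarrow> [n]\<close>, \<open>Op X m n \<theta>\<close> is the induced map \<open>Simp X n \<rightarrow> Simp X m\<close>.\<close>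

record 'x sset =
  Simp :: "nat \<Rightarrow> 'x set"
  Op :: "nat \<Rightarrow> nat \<Rightarrow> (nat \<Rightarrow> nat) \<Rightarrow> 'x \<Rightarrow> 'x"

locale simplicial_set =
  fixes X :: "'x sset"
  assumes Op_closed: "\<lbrakk>\<theta> \<in> simplex_maps m n; x \<in> Simp X n\<rbrakk> \<Longrightarrow> Op X m n \<theta> x \<in> Simp X m"
    and Op_id: "x \<in> Simp X n \<Longrightarrow> Op X n n (\<lambda>i\<in>{..n}. i) x = x"
    and Op_compose:
      "\<lbrakk>\<phi> \<in> simplex_maps k m; \<theta> \<in> simplex_maps m n; x \<in> Simp X n\<rbrakk>
        \<Longrightarrow> Op X k n (compose {..k} \<theta> \<phi>) x = Op X k m \<phi> (Op X m n \<theta> x)"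

definition nerve ::
    "('o, 'm) cat \<Rightarrow> ((nat \<Rightarrow> 'o) \<times> (nat \<times> nat \<Rightarrow> 'm)) sset" where
  "nerve C =
    \<lparr>Simp = (\<lambda>n. functors (ordinal_cat n) C),
     Op = (\<lambda>m n \<theta> (F, G).
       (\<lambda>i\<in>Obj (ordinal_cat m). F (\<theta> i), \<lambda>(i, j)\<in>Mor (ordinal_cat m). G (\<theta> i, \<theta> j)))\<rparr>"

lemma simplicial_set_nerve: "simplicial_set (nerve C)"
proof
  show "Op (nerve C) m n \<theta> x \<in> Simp (nerve C) m"
    if "\<theta> \<in> simplex_maps m n" "x \<in> Simp (nerve C) n" for \<theta> m n x
  proof -
    have le: "\<theta> i \<le> \<theta> j" if "i \<le> j" "j \<le> m" for i j
      using \<open>\<theta> \<in> _\<close> that by (auto simp: simplex_maps_def intro: mono_onD)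
    have ran: "\<theta> i \<le> n" if "i \<le> m" for i
      using \<open>\<theta> \<in> _\<close> that by (auto simp: simplex_maps_def)
    obtain F G where x: "x = (F, G)" by (cases x)
    show ?thesis
      using that(2) le ran unfolding x
      by (auto simp: nerve_def functors_def ordinal_cat_def PiE_iff extensional_def)
  qed
  show "Op (nerve C) n n (\<lambda>i\<in>{..n}. i) x = x" if "x \<in> Simp (nerve C) n" for x n
  proof -
    obtain F G where x: "x = (F, G)" by (cases x)
    have FG: "F \<in> extensional {..n}" "G \<in> extensional {(i, j). i \<le> j \<and> j \<le> n}"
      using that unfolding x by (simp_all add: nerve_def functors_def ordinal_cat_def PiE_def)
    have "(\<lambda>i\<in>{..n}. F ((\<lambda>i\<in>{..n}. i) i)) = F"
      by (rule extensionalityI [OF _ FG(1)]) auto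
    moreover have "(\<lambda>(i, j)\<in>{(i, j). i \<le> j \<and> j \<le> n}.
        G ((\<lambda>i\<in>{..n}. i) i, (\<lambda>i\<in>{..n}. i) j)) = G"
      by (rule extensionalityI [OF _ FG(2)]) auto
    ultimately show ?thesis
      unfolding x by (simp add: nerve_def ordinal_cat_def)
  qed
  show "Op (nerve C) k n (compose {..k} \<theta> \<phi>) x = Op (nerve C) k m \<phi> (Op (nerve C) m n \<theta> x)"
    if "\<phi> \<in> simplex_maps k m" "\<theta> \<in> simplex_maps m n" "x \<in> Simp (nerve C) n" for \<phi> k m \<theta> n x
  proof -
    have le: "\<phi> i \<le> \<phi> j" if "i \<le> j" "j \<le> k" for i j
      using \<open>\<phi> \<in> _\<close> that by (auto simp: simplex_maps_def intro: mono_onD)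
    have ran: "\<phi> i \<le> m" if "i \<le> k" for i
      using \<open>\<phi> \<in> _\<close> that by (auto simp: simplex_maps_def)
    obtain F G where x: "x = (F, G)" by (cases x)
    show ?thesis
      using le ran unfolding x
      by (auto simp: nerve_def ordinal_cat_def compose_def fun_eq_iff)
  qed
qed


section \<open>Geometric realization\<close>

text \<open>\<open>simplex_push m \<theta>\<close> is the affine map of standard simplices that sends vertex \<open>i \<le> m\<close> to
  vertex \<open>\<theta> i\<close>.\<close>

definition simplex_push :: "nat \<Rightarrow> (nat \<Rightarrow> nat) \<Rightarrow> (nat \<Rightarrow> real) \<Rightarrow> nat \<Rightarrow> real" where
  "simplex_push m \<theta> t = (\<lambda>j. \<Sum>i | i \<le> m \<and> \<theta> i = j. t i)"

text \<open>The disjoint union over \<open>n\<close> of \<open>Simp X n \<times> \<Delta>\<^sup>n\<close>, with \<open>Simp X n\<close> discrete.\<close>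

definition presentation_space :: "'x sset \<Rightarrow> (nat \<times> 'x \<times> (nat \<Rightarrow> real)) topology" where
  "presentation_space X =
    sum_topology
      (\<lambda>n. prod_topology (discrete_topology (Simp X n))
                         (subtopology (powertop_real UNIV) (standard_simplex n))) UNIV"

definition gluing ::
    "'x sset \<Rightarrow> ((nat \<times> 'x \<times> (nat \<Rightarrow> real)) \<times> (nat \<times> 'x \<times> (nat \<Rightarrow> real))) set" where
  "gluing X =
    {((m, Op X m n \<theta> x, t), (n, x, simplex_push m \<theta> t)) | m n \<theta> x t.
      \<theta> \<in> simplex_maps m n \<and> x \<in> Simp X n \<and> t \<in> standard_simplex m}"

text \<open>The equivalence relation generated by \<open>gluing X\<close>.\<close>

definition gluing_equiv ::
    "'x sset \<Rightarrow> ((nat \<times> 'x \<times> (nat \<Rightarrow> real)) \<times> (nat \<times> 'x \<times> (nat \<Rightarrow> real))) set" where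
  "gluing_equiv X = (gluing X \<union> (gluing X)\<inverse>)\<^sup>*"

text \<open>The quotient topology; see \<open>quotient_map_realization\<close> below.\<close>

definition realization :: "'x sset \<Rightarrow> (nat \<times> 'x \<times> (nat \<Rightarrow> real)) set topology" where
  "realization X =
    topology (\<lambda>U. U \<subseteq> topspace (presentation_space X) // gluing_equiv X \<and>
      openin (presentation_space X)
        {p \<in> topspace (presentation_space X). gluing_equiv X `` {p} \<in> U})"

lemma openin_realization:
  "openin (realization X) U \<longleftrightarrow>
    U \<subseteq> topspace (presentation_space X) // gluing_equiv X \<and>
    openin (presentation_space X)
      {p \<in> topspace (presentation_space X). gluing_equiv X `` {p} \<in> U}"
proof -
  let ?P = "presentation_space X"
  let ?q = "\<lambda>p. gluing_equiv X `` {p}"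
  let ?pre = "\<lambda>U. {p \<in> topspace ?P. ?q p \<in> U}"
  have Int: "?pre (S \<inter> T) = ?pre S \<inter> ?pre T" for S T
    by auto
  have Un: "?pre (\<Union>K) = (\<Union>S\<in>K. ?pre S)" for K
    by auto
  have "istopology (\<lambda>U. U \<subseteq> topspace ?P // gluing_equiv X \<and> openin ?P (?pre U))"
    unfolding istopology_def Int Un by blast
  then show ?thesis
    by (simp add: realization_def)
qed

lemma topspace_realization:
  "topspace (realization X) = topspace (presentation_space X) // gluing_equiv X"
proof
  show "topspace (realization X) \<subseteq> topspace (presentation_space X) // gluing_equiv X"
    using openin_realization [of X "topspace (realization X)"] by simp
  have "{p \<in> topspace (presentation_space X).
      gluing_equiv X `` {p} \<in> topspace (presentation_space X) // gluing_equiv X}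
      = topspace (presentation_space X)"
    by (auto intro: quotientI)
  then have "openin (realization X) (topspace (presentation_space X) // gluing_equiv X)"
    by (simp add: openin_realization)
  then show "topspace (presentation_space X) // gluing_equiv X \<subseteq> topspace (realization X)"
    by (rule openin_subset)
qed

lemma quotient_map_realization:
  "quotient_map (presentation_space X) (realization X) (\<lambda>p. gluing_equiv X `` {p})"
  unfolding quotient_map_def
  by (auto simp: topspace_realization openin_realization quotient_def)


section \<open>Euler characteristic\<close>

text \<open>The rank of a commutative group, written multiplicatively as homology groups are in
  HOL-Homology: the largest size of a set that is linearly independent over the integers.\<close>

definition int_independent :: "('a, 'b) monoid_scheme \<Rightarrow> 'a set \<Rightarrow> bool" where
  "int_independent G B \<longleftrightarrow> finite B \<and> B \<subseteq> carrier G \<and>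
    (\<forall>c :: 'a \<Rightarrow> int. finprod G (\<lambda>b. b [^]\<^bsub>G\<^esub> c b) B = \<one>\<^bsub>G\<^esub> \<longrightarrow> (\<forall>b \<in> B. c b = 0))"

definition group_rank :: "('a, 'b) monoid_scheme \<Rightarrow> nat" where
  "group_rank G = Sup (card ` {B. int_independent G B})"

text \<open>The alternating sum of Betti numbers in singular homology. It is meaningful when all Betti
  numbers are finite and almost all of them vanish, as for finite CW complexes.\<close>

definition betti :: "nat \<Rightarrow> 'a topology \<Rightarrow> nat" where
  "betti p X = group_rank (homology_group (int p) X)"

definition euler_characteristic :: "'a topology \<Rightarrow> int" where
  "euler_characteristic X = (\<Sum>p | betti p X \<noteq> 0. (-1) ^ p * int (betti p X))"

end

theory Submission
  imports Defs
begin

text \<open>In a finite skeletal category \<open>C\<close> without nontrivial endomorphisms there are no maps back along a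
  non-identity map: maps \<open>a \<rightarrow> b \<rightarrow> a\<close> compose to identities on both sides, so that \<open>a = b\<close>. Hence
  the objects of a chain of non-identity maps are distinct, faces of nondegenerate simplices of the
  nerve are nondegenerate, and \<open>|NC|\<close> is a finite cell complex whose \<open>n\<close>-cells are the chains of \<open>n\<close>
  composable non-identity maps. Its Euler characteristic is the alternating sum of the numbers of
  these chains. A chain is just a walk of \<open>n\<close> arcs that are not loops, and whether two arcs are
  consecutive depends on the directed graph alone: composition governs how the cells are glued, but
  not how many of them there are.

  The work lies in proving, for singular homology, that the Euler characteristic counts cells. It
  rests on three facts.

  Ranks of commutative groups add up over kernel and image (\<open>has_rank_kernel_image\<close>,
  \<open>has_rank_split\<close>). So the long exact sequence of a pair makes the Euler characteristic additive, and
  by excision \<open>\<chi>(X) = \<chi>(T) + \<chi>(X - U) - \<chi>(T - U)\<close> whenever \<open>U\<close> can be excised from \<open>(X, T)\<close>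
  (\<open>has_euler_excision\<close>).

  For a complex of simplices in a space of real functions, let \<open>M\<close> be a cell of maximal dimension.
  Without its barycenter the complex retracts onto the union of the other cells, and \<open>M\<close> without its
  barycenter retracts onto the boundary of \<open>M\<close>; excising the complement of \<open>M\<close> therefore computes the
  Euler characteristic from those of smaller complexes and of the contractible cell \<open>M\<close>. Induction
  on the number of cells, started by the full simplices, gives the cell count
  (\<open>has_euler_polyhedron\<close>).

  The realization of the nerve is homeomorphic to such a complex in the functions on the maps of \<open>C\<close>
  (\<open>realization_homeomorphic_polyhedron\<close>). A point of a simplex is a weighted chain; it is sent to the
  function that takes a map \<open>f : a \<rightarrow> b\<close> of the chain to the product of the weights of \<open>a\<close> and \<open>b\<close>, or
  to the weight of \<open>a\<close> if \<open>f\<close> is the identity of \<open>a\<close>, and the other maps to \<open>0\<close>. The maps with nonzero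
  value then spell out the part of the chain with positive weights, which is why points that are not
  glued together stay apart.\<close>

section \<open>Ranks of commutative groups\<close>

definition lincomb :: "('a, 'b) monoid_scheme \<Rightarrow> ('i \<Rightarrow> 'a) \<Rightarrow> 'i set \<Rightarrow> ('i \<Rightarrow> int) \<Rightarrow> 'a" where
  "lincomb G v I c = finprod G (\<lambda>i. v i [^]\<^bsub>G\<^esub> c i) I"

text \<open>Independence of families rather than of sets: lifted or modified elements are given by an
  indexing map, and injectivity of that map is a consequence (\<open>independent_family_inj\<close>).\<close>

definition independent_family :: "('a, 'b) monoid_scheme \<Rightarrow> ('i \<Rightarrow> 'a) \<Rightarrow> 'i set \<Rightarrow> bool" where
  "independent_family G v I \<longleftrightarrow> finite I \<and> v \<in> I \<rightarrow> carrier G \<and>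
    (\<forall>c. lincomb G v I c = \<one>\<^bsub>G\<^esub> \<longrightarrow> (\<forall>i\<in>I. c i = 0))"

lemma int_independent_iff_family: "int_independent G B \<longleftrightarrow> independent_family G (\<lambda>b. b) B"
  by (auto simp: int_independent_def independent_family_def lincomb_def)

context comm_group
begin

lemma lincomb_closed: "v \<in> I \<rightarrow> carrier G \<Longrightarrow> lincomb G v I c \<in> carrier G"
  unfolding lincomb_def by (intro finprod_closed) auto

lemma lincomb_cong:
  assumes "v \<in> I \<rightarrow> carrier G" "\<And>i. i \<in> I \<Longrightarrow> c i = d i"
  shows "lincomb G v I c = lincomb G v I d"
  unfolding lincomb_def using assms by (intro finprod_cong') auto

lemma lincomb_zero: "lincomb G v I (\<lambda>i. 0) = \<one>"
  unfolding lincomb_def by (rule finprod_one_eqI) simp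

lemma lincomb_add:
  assumes "v \<in> I \<rightarrow> carrier G"
  shows "lincomb G v I (\<lambda>i. c i + d i) = lincomb G v I c \<otimes> lincomb G v I d"
proof -
  have "lincomb G v I (\<lambda>i. c i + d i) = finprod G (\<lambda>i. v i [^] c i \<otimes> v i [^] d i) I"
    unfolding lincomb_def using assms by (intro finprod_cong') (auto simp: int_pow_mult Pi_iff)
  then show ?thesis
    unfolding lincomb_def using assms by (subst (asm) finprod_multf) auto
qed

lemma finprod_int_pow:
  assumes "finite I" "v \<in> I \<rightarrow> carrier G"
  shows "finprod G v I [^] (n::int) = finprod G (\<lambda>i. v i [^] n) I"
  using assms
proof (induction I rule: finite_induct)
  case empty
  then show ?case by simp
next
  case (insert x F)
  have *: "v \<in> F \<rightarrow> carrier G" "v x \<in> carrier G" using insert.prems by auto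
  show ?case
    using insert.hyps * insert.IH
    by (subst finprod_insert, auto simp: int_pow_distrib) (subst finprod_insert, auto)
qed

lemma lincomb_scale:
  assumes "finite I" "v \<in> I \<rightarrow> carrier G"
  shows "lincomb G v I (\<lambda>i. c i * n) = lincomb G v I c [^] n"
  unfolding lincomb_def using assms
  by (subst finprod_int_pow) (auto simp: int_pow_pow Pi_iff intro!: finprod_cong')

lemma lincomb_lincomb:
  assumes "finite I" "v \<in> I \<rightarrow> carrier G" "finite J"
  shows "lincomb G (\<lambda>j. lincomb G v I (C j)) J d = lincomb G v I (\<lambda>i. \<Sum>j\<in>J. C j i * d j)"
  using assms(3)
proof (induction J rule: finite_induct)
  case empty
  then show ?case by (simp add: lincomb_zero) (simp add: lincomb_def)
next
  case (insert j J)
  have "lincomb G (\<lambda>j. lincomb G v I (C j)) (insert j J) d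
      = lincomb G v I (C j) [^] d j \<otimes> lincomb G (\<lambda>j. lincomb G v I (C j)) J d"
    unfolding lincomb_def[of _ _ "insert j J"] lincomb_def[of _ _ J]
    using insert.hyps lincomb_closed[OF assms(2)] by (subst finprod_insert) auto
  then show ?case
    using insert lincomb_add[OF assms(2)] by (simp add: lincomb_scale assms)
qed

lemma lincomb_mono_neutral:
  assumes "finite I" "J \<subseteq> I" "v \<in> I \<rightarrow> carrier G" "\<And>i. i \<in> I - J \<Longrightarrow> c i = 0"
  shows "lincomb G v I c = lincomb G v J c"
  unfolding lincomb_def
  using assms by (intro finprod_mono_neutral_cong_right) auto

lemma lincomb_image:
  assumes "inj_on w I" "v \<in> w ` I \<rightarrow> carrier G"
  shows "lincomb G v (w ` I) c = lincomb G (v \<circ> w) I (c \<circ> w)"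
  unfolding lincomb_def comp_def using assms by (intro finprod_reindex) auto

lemma independent_family_inj:
  assumes "independent_family G v I"
  shows "inj_on v I"
proof (rule inj_onI, rule ccontr)
  fix i j assume ij: "i \<in> I" "j \<in> I" "v i = v j" "i \<noteq> j"
  let ?c = "\<lambda>k. if k = i then 1 else if k = j then -1 else (0::int)"
  have v: "finite I" "v \<in> I \<rightarrow> carrier G" using assms by (auto simp: independent_family_def)
  have "lincomb G v I ?c = lincomb G v {i, j} ?c"
    using v ij by (intro lincomb_mono_neutral) auto
  also have "\<dots> = \<one>"
  proof -
    have "v j \<in> carrier G" using v ij by auto
    then show ?thesis
    unfolding lincomb_def using ij
    by (subst finprod_insert) (auto simp: int_pow_neg)
  qed
  finally have "?c i = 0" using assms ij unfolding independent_family_def by blast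
  then show False by simp
qed

lemma independent_family_image:
  assumes "independent_family G v I"
  shows "int_independent G (v ` I)" "card (v ` I) = card I"
proof -
  have inj: "inj_on v I" using assms by (rule independent_family_inj)
  then show "card (v ` I) = card I" by (rule card_image)
  have v: "finite I" "v \<in> I \<rightarrow> carrier G" using assms by (auto simp: independent_family_def)
  show "int_independent G (v ` I)"
    unfolding int_independent_iff_family independent_family_def
  proof (intro conjI allI impI ballI)
    fix c b assume "lincomb G (\<lambda>b. b) (v ` I) c = \<one>" and b: "b \<in> v ` I"
    then have "lincomb G v I (c \<circ> v) = \<one>"
      using v inj by (subst (asm) lincomb_image) (auto simp: comp_def)
    then show "c b = 0" using b assms by (auto simp: independent_family_def)
  qed (use v in auto)
qed

end

lemma hom_lincomb:
  assumes "comm_group G" "comm_group H" "f \<in> hom G H" "finite I" "v \<in> I \<rightarrow> carrier G"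
  shows "f (lincomb G v I c) = lincomb H (f \<circ> v) I c"
proof -
  interpret G: comm_group G by fact
  interpret H: comm_group H by fact
  interpret group_hom G H f by unfold_locales fact
  show ?thesis
    using assms(4,5)
  proof (induction I rule: finite_induct)
    case empty
    then show ?case by (simp add: lincomb_def)
  next
    case (insert x F)
    then have v: "v x \<in> carrier G" "v \<in> F \<rightarrow> carrier G" by auto
    have "lincomb G v (insert x F) c = v x [^]\<^bsub>G\<^esub> c x \<otimes>\<^bsub>G\<^esub> lincomb G v F c"
      unfolding lincomb_def using insert.hyps v by (subst G.finprod_insert) auto
    moreover have "lincomb H (f \<circ> v) (insert x F) c = f (v x) [^]\<^bsub>H\<^esub> c x \<otimes>\<^bsub>H\<^esub> lincomb H (f \<circ> v) F c"
      unfolding lincomb_def using insert.hyps v by (subst H.finprod_insert) (auto simp: Pi_iff)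
    ultimately show ?case
      using insert.IH[OF v(2)] v by (simp only:) (simp only: hom_int_pow G.lincomb_closed hom_mult G.int_pow_closed)
  qed
qed

text \<open>A relation rather than a function, so that it also says that the rank is finite: the supremum in
  \<^const>\<open>group_rank\<close> carries no information for unbounded sets. The rank is taken over a subset \<open>K\<close> of
  \<open>G\<close>, which spares a group structure on kernels and images.\<close>

definition has_rank :: "('a, 'b) monoid_scheme \<Rightarrow> 'a set \<Rightarrow> nat \<Rightarrow> bool" where
  "has_rank G K n \<longleftrightarrow> (\<exists>B\<subseteq>K. int_independent G B \<and> card B = n) \<and>
    (\<forall>B\<subseteq>K. int_independent G B \<longrightarrow> card B \<le> n)"

lemma has_rank_unique: "has_rank G K m \<Longrightarrow> has_rank G K n \<Longrightarrow> m = n"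
  unfolding has_rank_def by (metis le_antisym)

lemma has_rank_group_rank:
  assumes "has_rank G (carrier G) n"
  shows "group_rank G = n"
proof -
  have "\<forall>B. int_independent G B \<longrightarrow> B \<subseteq> carrier G" by (simp add: int_independent_def)
  then show ?thesis
    unfolding group_rank_def using assms
    by (intro cSup_eq_maximum) (auto simp: has_rank_def)
qed

lemma has_rank_of_bound:
  assumes "\<And>B. B \<subseteq> K \<Longrightarrow> int_independent G B \<Longrightarrow> card B \<le> N"
  obtains n where "has_rank G K n" "n \<le> N"
proof -
  let ?P = "\<lambda>n. \<exists>B\<subseteq>K. int_independent G B \<and> card B = n"
  have "?P 0" by (intro exI[of _ "{}"]) (auto simp: int_independent_def)
  moreover have b: "\<forall>n. ?P n \<longrightarrow> n \<le> N" using assms by blast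
  ultimately have "?P (GREATEST n. ?P n)" using GreatestI_nat[of ?P 0 N] by blast
  moreover have "card B \<le> (GREATEST n. ?P n)" if "B \<subseteq> K" "int_independent G B" for B
    by (rule Greatest_le_nat[where b = N]) (use that b in auto)
  ultimately have "has_rank G K (GREATEST n. ?P n)" unfolding has_rank_def by blast
  with b show ?thesis using that unfolding has_rank_def by blast
qed

lemma has_rank_subset:
  assumes "has_rank G K n" "L \<subseteq> K"
  obtains m where "has_rank G L m" "m \<le> n"
  using assms by (elim has_rank_of_bound[of L G n, rotated]) (auto simp: has_rank_def)

text \<open>Choose preimages of the elements of \<open>I\<close>. The image under \<open>f\<close> of a relation between them and \<open>K\<close>
  is a relation on \<open>I\<close>, so the coefficients of the preimages vanish and a relation on \<open>K\<close> is left.\<close>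

lemma independent_lift:
  assumes "comm_group G" "comm_group H" and f: "f \<in> hom G H"
    and "K \<subseteq> kernel G H f" "int_independent G K"
    and "I \<subseteq> f ` carrier G" "int_independent H I"
  obtains B where "int_independent G B" "card B = card K + card I"
proof -
  interpret G: comm_group G by fact
  interpret H: comm_group H by fact
  interpret group_hom G H f by unfold_locales fact
  define s where "s y = (SOME x. x \<in> carrier G \<and> f x = y)" for y
  have s: "s y \<in> carrier G" "f (s y) = y" if "y \<in> I" for y
    using that assms(6) someI_ex[of "\<lambda>x. x \<in> carrier G \<and> f x = y"] unfolding s_def by auto
  have fin: "finite K" "finite I" "K \<subseteq> carrier G" "I \<subseteq> carrier H"
    using assms by (auto simp: int_independent_def)
  let ?v = "case_sum (\<lambda>k. k) s"
  let ?J = "K <+> I"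
  have v: "?v \<in> ?J \<rightarrow> carrier G" using s fin by auto
  have "independent_family G ?v ?J"
    unfolding independent_family_def
  proof (intro conjI allI impI)
    fix c assume c: "lincomb G ?v ?J c = \<one>\<^bsub>G\<^esub>"
    have "f (lincomb G ?v ?J c) = lincomb H (f \<circ> ?v) ?J c"
      using fin v by (intro hom_lincomb assms) auto
    also have "\<dots> = finprod H (\<lambda>i. (f \<circ> ?v) i [^]\<^bsub>H\<^esub> c i) (Inr ` I)"
      unfolding lincomb_def using fin s assms(4)
      by (intro H.finprod_mono_neutral_cong_right) (auto simp: kernel_def)
    also have "\<dots> = lincomb H (\<lambda>y. y) I (c \<circ> Inr)"
      unfolding lincomb_def comp_def using fin s
      by (subst H.finprod_reindex) (auto intro!: H.finprod_cong')
    finally have "lincomb H (\<lambda>y. y) I (c \<circ> Inr) = \<one>\<^bsub>H\<^esub>" using c by simp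
    then have I0: "c (Inr i) = 0" if "i \<in> I" for i
      using assms(7) that by (auto simp: int_independent_iff_family independent_family_def)
    have "lincomb G ?v ?J c = lincomb G ?v (Inl ` K) c"
      using fin v I0 by (intro G.lincomb_mono_neutral) auto
    also have "\<dots> = lincomb G (\<lambda>k. k) K (c \<circ> Inl)"
      using fin by (subst G.lincomb_image) (auto simp: comp_def)
    finally have "c (Inl k) = 0" if "k \<in> K" for k
      using assms(5) that c by (auto simp: int_independent_iff_family independent_family_def)
    with I0 show "\<forall>i\<in>?J. c i = 0" by auto
  qed (use fin v in auto)
  from G.independent_family_image[OF this] that show ?thesis
    using fin by (simp add: card_Plus)
qed

text \<open>Take a maximal \<open>C \<subseteq> B\<close> on which \<open>f\<close> is an independent family. By maximality every \<open>b \<in> B - C\<close> has a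
  nonzero multiple that agrees under \<open>f\<close> with a combination of \<open>C\<close>; the differences lie in the
  kernel, and they are independent because \<open>b\<close> occurs in its own difference only.\<close>

lemma independent_split:
  assumes "comm_group G" "comm_group H" and f: "f \<in> hom G H" and B: "int_independent G B"
  obtains K I where "K \<subseteq> kernel G H f" "int_independent G K"
    "I \<subseteq> f ` carrier G" "int_independent H I" "card B = card K + card I"
proof -
  interpret G: comm_group G by fact
  interpret H: comm_group H by fact
  interpret group_hom G H f by unfold_locales fact
  have Bc: "finite B" "B \<subseteq> carrier G" using B by (auto simp: int_independent_def)
  let ?P = "\<lambda>n. \<exists>C\<subseteq>B. independent_family H f C \<and> card C = n"
  have "?P 0" by (intro exI[of _ "{}"]) (auto simp: independent_family_def)
  moreover have bd: "\<forall>n. ?P n \<longrightarrow> n \<le> card B" using Bc by (auto intro: card_mono)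
  ultimately have "?P (GREATEST n. ?P n)" using GreatestI_nat[of ?P 0 "card B"] by blast
  then obtain C where C: "C \<subseteq> B" "independent_family H f C" and Cn: "card C = (GREATEST n. ?P n)"
    by blast
  have Cmax: "card D \<le> card C" if "D \<subseteq> B" "independent_family H f D" for D
    unfolding Cn by (rule Greatest_le_nat[where b = "card B"]) (use that bd in auto)
  have finC: "finite C" using C Bc by (metis finite_subset)
  have "\<exists>c. c b \<noteq> 0 \<and> (\<forall>x\<in>B - insert b C. c x = 0) \<and> lincomb G (\<lambda>x. x) B c \<in> kernel G H f"
    if b: "b \<in> B - C" for b
  proof -
    have fi: "f \<in> insert b C \<rightarrow> carrier H" using b C Bc by auto
    have "\<not> independent_family H f (insert b C)"
      using Cmax[of "insert b C"] b C finC by auto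
    then have "\<not> (\<forall>c. lincomb H f (insert b C) c = \<one>\<^bsub>H\<^esub> \<longrightarrow> (\<forall>x\<in>insert b C. c x = 0))"
      using fi finC unfolding independent_family_def by blast
    then obtain c where c: "lincomb H f (insert b C) c = \<one>\<^bsub>H\<^esub>" "\<exists>x\<in>insert b C. c x \<noteq> 0"
      by blast
    have cb: "c b \<noteq> 0"
    proof
      assume "c b = 0"
      then have "lincomb H f C c = \<one>\<^bsub>H\<^esub>"
        using c(1) fi finC by (subst (asm) H.lincomb_mono_neutral[where J = C]) auto
      then show False using C c(2) \<open>c b = 0\<close> unfolding independent_family_def by auto
    qed
    \<comment> \<open>Extended by \<open>0\<close> to all of \<open>B\<close>, so that all these combinations range over the same index set.\<close>
    let ?c = "\<lambda>x. if x \<in> insert b C then c x else 0"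
    have "f (lincomb G (\<lambda>x. x) B ?c) = lincomb H (f \<circ> (\<lambda>x. x)) B ?c"
      using Bc by (intro hom_lincomb assms) auto
    also have "\<dots> = lincomb H f (insert b C) ?c"
      unfolding comp_def using Bc b C by (intro H.lincomb_mono_neutral) auto
    also have "\<dots> = lincomb H f (insert b C) c"
      using fi by (intro H.lincomb_cong) auto
    finally have "lincomb G (\<lambda>x. x) B ?c \<in> kernel G H f"
      using c Bc by (auto simp: kernel_def intro!: G.lincomb_closed)
    then show ?thesis using cb by (intro exI[of _ ?c]) auto
  qed
  then have "\<forall>b\<in>B - C. \<exists>c. c b \<noteq> 0 \<and> (\<forall>x\<in>B - insert b C. c x = 0) \<and> lincomb G (\<lambda>x. x) B c \<in> kernel G H f"
    by (rule ballI)
  from bchoice[OF this] obtain c where "\<forall>b\<in>B - C. c b b \<noteq> 0 \<and> (\<forall>x\<in>B - insert b C. c b x = 0) \<and>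
      lincomb G (\<lambda>x. x) B (c b) \<in> kernel G H f" ..
  then have c: "\<And>b. b \<in> B - C \<Longrightarrow> c b b \<noteq> 0"
    "\<And>b x. b \<in> B - C \<Longrightarrow> x \<in> B - insert b C \<Longrightarrow> c b x = 0"
    "\<And>b. b \<in> B - C \<Longrightarrow> lincomb G (\<lambda>x. x) B (c b) \<in> kernel G H f"
    by blast+
  let ?k = "\<lambda>b. lincomb G (\<lambda>x. x) B (c b)"
  have "independent_family G ?k (B - C)"
    unfolding independent_family_def
  proof (intro conjI allI impI ballI)
    fix d b assume d: "lincomb G ?k (B - C) d = \<one>\<^bsub>G\<^esub>" and b: "b \<in> B - C"
    have "lincomb G (\<lambda>x. x) B (\<lambda>x. \<Sum>j\<in>B - C. c j x * d j) = \<one>\<^bsub>G\<^esub>"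
      using d Bc by (subst G.lincomb_lincomb[symmetric]) auto
    then have "(\<Sum>j\<in>B - C. c j b * d j) = 0"
      using B b by (auto simp: int_independent_iff_family independent_family_def)
    moreover have "(\<Sum>j\<in>B - C. c j b * d j) = (\<Sum>j\<in>{b}. c j b * d j)"
      using Bc b c(2) by (intro sum.mono_neutral_right) auto
    ultimately show "d b = 0" using c(1)[OF b] by simp
  qed (use Bc in \<open>auto intro!: G.lincomb_closed\<close>)
  note K = G.independent_family_image[OF this] and I = H.independent_family_image[OF C(2)]
  have "card B = card (B - C) + card C"
    using card_Diff_subset[OF finC C(1)] card_mono[OF Bc(1) C(1)] by simp
  then have "card B = card (?k ` (B - C)) + card (f ` C)"
    using K(2) I(2) by (simp only:)
  moreover have "?k ` (B - C) \<subseteq> kernel G H f" using c(3) by blast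
  moreover have "f ` C \<subseteq> f ` carrier G" using C Bc by blast
  ultimately show ?thesis using K(1) I(1) by (intro that)
qed

lemma has_rank_kernel_image:
  assumes "comm_group G" "comm_group H" and f: "f \<in> hom G H"
  shows "has_rank G (kernel G H f) k \<Longrightarrow> has_rank H (f ` carrier G) i \<Longrightarrow> has_rank G (carrier G) (k + i)"
proof -
  assume k: "has_rank G (kernel G H f) k" and i: "has_rank H (f ` carrier G) i"
  obtain K I where "K \<subseteq> kernel G H f" "int_independent G K" "card K = k"
    "I \<subseteq> f ` carrier G" "int_independent H I" "card I = i"
    using k i unfolding has_rank_def by blast
  with independent_lift[OF assms, of K I]
  obtain B where B: "int_independent G B" "card B = k + i" by auto
  moreover have "card B' \<le> k + i" if B': "int_independent G B'" for B'
  proof -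
    obtain K' I' where "K' \<subseteq> kernel G H f" "int_independent G K'"
      "I' \<subseteq> f ` carrier G" "int_independent H I'" "card B' = card K' + card I'"
      by (rule independent_split[OF assms B'])
    then show ?thesis using k i unfolding has_rank_def by (simp add: add_mono)
  qed
  ultimately show ?thesis unfolding has_rank_def by (auto simp: int_independent_def)
qed

lemma has_rank_split:
  assumes "comm_group G" "comm_group H" and f: "f \<in> hom G H" and n: "has_rank G (carrier G) n"
  obtains k i where "has_rank G (kernel G H f) k" "has_rank H (f ` carrier G) i" "n = k + i"
proof -
  obtain k where k: "has_rank G (kernel G H f) k"
    using has_rank_subset[OF n, of "kernel G H f"] by (auto simp: kernel_def)
  have "card I \<le> n" if "I \<subseteq> f ` carrier G" "int_independent H I" for I
  proof -
    have e: "int_independent G {}" by (simp add: int_independent_def)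
    obtain B where B: "int_independent G B" "card B = card I"
      by (rule independent_lift[OF assms(1-3) empty_subsetI e \<open>I \<subseteq> f ` carrier G\<close> \<open>int_independent H I\<close>]) (rule that, auto)
    then have "B \<subseteq> carrier G" by (simp add: int_independent_def)
    then show ?thesis using n B by (auto simp: has_rank_def)
  qed
  with has_rank_of_bound[of "f ` carrier G" H n]
  obtain i where i: "has_rank H (f ` carrier G) i" by blast
  show ?thesis
    by (rule that[OF k i has_rank_unique[OF n has_rank_kernel_image[OF assms(1-3) k i]]])
qed

lemma has_rank_one:
  assumes "comm_group G"
  shows "has_rank G {\<one>\<^bsub>G\<^esub>} 0"
proof -
  interpret comm_group G by fact
  have "B = {}" if "B \<subseteq> {\<one>\<^bsub>G\<^esub>}" "int_independent G B" for B
  proof (rule ccontr)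
    assume "B \<noteq> {}"
    with that have B: "B = {\<one>\<^bsub>G\<^esub>}" by auto
    have "finprod G (\<lambda>b. b [^]\<^bsub>G\<^esub> (1::int)) B = \<one>\<^bsub>G\<^esub>"
      using B by (intro finprod_one_eqI) auto
    then have "(1::int) = 0"
      using that(2) B unfolding int_independent_def
      by (auto dest: spec[of _ "\<lambda>_. 1"])
    then show False by simp
  qed
  then show ?thesis
    unfolding has_rank_def by (force simp: int_independent_def)
qed

lemma has_rank_trivial_group:
  assumes "comm_group G" "trivial_group G"
  shows "has_rank G (carrier G) 0"
  using has_rank_one[OF assms(1)] assms(2) by (simp add: trivial_group_def)

lemma has_rank_iso:
  assumes "comm_group G" "comm_group H" "G \<cong> H" "has_rank H (carrier H) n"
  shows "has_rank G (carrier G) n"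
proof -
  obtain f where f: "f \<in> hom G H" "bij_betw f (carrier G) (carrier H)"
    using assms(3) by (auto simp: is_iso_def iso_def)
  interpret G: comm_group G by fact
  interpret H: comm_group H by fact
  interpret group_hom G H f by unfold_locales fact
  have "kernel G H f = {\<one>\<^bsub>G\<^esub>}"
    using f(2) inj_iff_trivial_ker by (simp add: bij_betw_def)
  then have "has_rank G (kernel G H f) 0"
    using has_rank_one assms(1) by simp
  moreover have "f ` carrier G = carrier H" using f(2) by (simp add: bij_betw_def)
  ultimately show ?thesis
    using has_rank_kernel_image[OF assms(1,2) f(1), of 0 n] assms(4) by simp
qed

text \<open>Distinct integers \<open>a\<close> and \<open>b\<close> satisfy the nontrivial relation \<open>b a - a b = 0\<close>.\<close>

lemma has_rank_integer_group: "has_rank integer_group (carrier integer_group) 1"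
proof -
  interpret comm_group integer_group by (rule abelian_integer_group)
  have "int_independent integer_group {1::int}"
    unfolding int_independent_def
  proof (intro conjI allI impI ballI)
    fix c :: "int \<Rightarrow> int" and b :: int
    assume "finprod integer_group (\<lambda>b. b [^]\<^bsub>integer_group\<^esub> c b) {1} = \<one>\<^bsub>integer_group\<^esub>" "b \<in> {1}"
    then show "c b = 0" by (subst (asm) finprod_insert) auto
  qed auto
  moreover have "card B \<le> 1" if B: "int_independent integer_group B" for B
  proof (rule ccontr)
    assume "\<not> card B \<le> 1"
    moreover have fin: "finite B" using B by (simp add: int_independent_def)
    ultimately obtain a b where ab: "a \<in> B" "b \<in> B" "a \<noteq> b"
      by (metis One_nat_def card_le_Suc0_iff_eq)
    let ?c = "\<lambda>x. if x = a then b else if x = b then -a else 0"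
    have "lincomb integer_group (\<lambda>x. x) B ?c = lincomb integer_group (\<lambda>x. x) {a, b} ?c"
      using fin ab by (intro lincomb_mono_neutral) auto
    also have "\<dots> = \<one>\<^bsub>integer_group\<^esub>"
      unfolding lincomb_def using ab by (subst finprod_insert) auto
    finally have "\<forall>x\<in>B. ?c x = 0"
      using B unfolding int_independent_iff_family independent_family_def by blast
    with ab show False by (metis neg_equal_0_iff_equal)
  qed
  ultimately show ?thesis
    unfolding has_rank_def by (metis One_nat_def card.empty card_insert_disjoint empty_iff finite.emptyI int_independent_def)
qed

section \<open>Euler characteristic and excision\<close>

text \<open>Besides the value of the alternating sum this records that it makes sense: all ranks are finite
  and almost all of them are \<open>0\<close>. Both have to be carried through the inductions.\<close>

definition has_euler_groups :: "(nat \<Rightarrow> 'a monoid) \<Rightarrow> int \<Rightarrow> bool" where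
  "has_euler_groups G c \<longleftrightarrow> (\<exists>b N. (\<forall>p. has_rank (G p) (carrier (G p)) (b p)) \<and>
     (\<forall>p\<ge>N. b p = 0) \<and> c = (\<Sum>p<N. (-1) ^ p * int (b p)))"

abbreviation has_euler :: "'a topology \<Rightarrow> int \<Rightarrow> bool" where
  "has_euler X \<equiv> has_euler_groups (\<lambda>p. homology_group (int p) X)"

abbreviation has_relative_euler :: "'a topology \<Rightarrow> 'a set \<Rightarrow> int \<Rightarrow> bool" where
  "has_relative_euler X S \<equiv> has_euler_groups (\<lambda>p. relative_homology_group (int p) X S)"

lemma alternating_sum_extend:
  fixes b :: "nat \<Rightarrow> nat"
  assumes "\<forall>p\<ge>N. b p = 0" "N \<le> M"
  shows "(\<Sum>p<M. (-1) ^ p * int (b p)) = (\<Sum>p<N. (-1) ^ p * int (b p))"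
  using assms by (intro sum.mono_neutral_right) auto

lemma euler_characteristic_eq:
  assumes "has_euler X c"
  shows "euler_characteristic X = c"
proof -
  obtain b N where b: "\<forall>p. has_rank (homology_group (int p) X) (carrier (homology_group (int p) X)) (b p)"
     "\<forall>p\<ge>N. b p = 0" "c = (\<Sum>p<N. (-1) ^ p * int (b p))"
    using assms unfolding has_euler_groups_def by blast
  have betti: "betti p X = b p" for p
    unfolding betti_def using b(1) by (intro has_rank_group_rank) blast
  show ?thesis
    unfolding euler_characteristic_def betti b(3) using b(2)
    by (intro sum.mono_neutral_left) (auto simp: not_less[symmetric])
qed

lemma has_euler_groups_iso:
  assumes "has_euler_groups H c" "\<And>p. G p \<cong> H p" "\<And>p. comm_group (G p)" "\<And>p. comm_group (H p)"
  shows "has_euler_groups G c"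
  using assms has_rank_iso unfolding has_euler_groups_def by metis

lemma has_euler_homotopy_equivalent:
  assumes "X homotopy_equivalent_space Y" "has_euler Y c"
  shows "has_euler X c"
  using assms(2) homotopy_equivalent_space_imp_isomorphic_homology_groups[OF assms(1)]
  by (rule has_euler_groups_iso) (auto simp: abelian_homology_group)

lemma has_euler_empty:
  assumes "topspace X = {}"
  shows "has_euler X 0"
  unfolding has_euler_groups_def
  using has_rank_trivial_group[OF abelian_homology_group trivial_homology_group_empty[OF assms]]
  by (intro exI[of _ "\<lambda>_. 0"] exI[of _ 0]) auto

lemma has_euler_contractible:
  assumes "contractible_space X" "topspace X \<noteq> {}"
  shows "has_euler X 1"
proof -
  have "X \<noteq> trivial_topology" using assms(2) by (metis topspace_discrete_topology)
  then obtain a where a: "a \<in> topspace X" and eq: "X homotopy_equivalent_space subtopology X {a}"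
    using assms(1) unfolding contractible_eq_homotopy_equivalent_singleton_subtopology by blast
  let ?Y = "subtopology X {a}"
  have top: "topspace ?Y = {a}" using a by auto
  have Y: "has_euler ?Y 1"
    unfolding has_euler_groups_def
  proof (intro exI conjI allI impI)
    let ?b = "\<lambda>p::nat. if p = 0 then 1 else 0::nat"
    fix p
    show "has_rank (homology_group (int p) ?Y) (carrier (homology_group (int p) ?Y)) (?b p)"
    proof (cases "p = 0")
      case True
      then show ?thesis
        using has_rank_iso[OF abelian_homology_group abelian_integer_group homology_coefficients
           has_rank_integer_group, OF top] by simp
    next
      case False
      then show ?thesis
        using has_rank_trivial_group[OF abelian_homology_group homology_dimension_axiom[OF top]]
        by simp
    qed
    show "?b p = 0" if "1 \<le> p" using that by simp
  qed simp
  then show ?thesis using has_euler_homotopy_equivalent[OF eq] by blast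
qed

lemma alternating_telescope:
  fixes \<delta> :: "nat \<Rightarrow> int"
  shows "(\<Sum>p<N. (-1) ^ p * (\<delta> p + (case p of 0 \<Rightarrow> 0 | Suc q \<Rightarrow> \<delta> q))) =
    (case N of 0 \<Rightarrow> 0 | Suc q \<Rightarrow> (-1) ^ q * \<delta> q)"
  by (induction N) (auto simp: algebra_simps split: nat.split)

text \<open>The part of the long exact sequence of a pair that involves degree \<open>p\<close>, unpacked into kernels and
  images.\<close>

lemma homology_pair_ranks:
  fixes X :: "'a topology" and S :: "'a set" and p :: nat
  defines "A \<equiv> homology_group (int p) (subtopology X S)"
    and "Y \<equiv> homology_group (int p) X"
    and "R \<equiv> relative_homology_group (int p) X S"
    and "i \<equiv> hom_induced (int p) (subtopology X S) {} X {} id"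
    and "j \<equiv> hom_induced (int p) X {} X S id"
    and "d \<equiv> hom_boundary (int p) X S"
    and "D \<equiv> homology_group (int p - 1) (subtopology X S)"
  shows "i \<in> hom A Y" "j \<in> hom Y R" "d \<in> hom R D" 
    "kernel Y R j = i ` carrier A" "kernel R D d = j ` carrier Y"
    "comm_group A" "comm_group Y" "comm_group R" "comm_group D"
  using homology_exactness_axiom_1[of "int p" X S] homology_exactness_axiom_3[of "int p" X S]
  unfolding assms
  by (simp_all add: hom_induced_hom hom_boundary_hom abelian_homology_group)

lemma boundary_image:
  "hom_boundary (int (Suc q)) X S ` carrier (relative_homology_group (int (Suc q)) X S) =
   kernel (homology_group (int q) (subtopology X S)) (homology_group (int q) X)
     (hom_induced (int q) (subtopology X S) {} X {} id)"
  using homology_exactness_axiom_2[of "int (Suc q)" X S] by simp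

text \<open>In the long exact sequence of a pair, \<open>\<delta>\<close>, \<open>\<iota>\<close> and \<open>\<kappa>\<close> are the ranks of the images of the boundary
  map (from degree \<open>p + 1\<close>), of the inclusion and of the projection. Each of the three homology groups
  is an extension of two consecutive images; in the alternating sum \<open>\<iota>\<close> and \<open>\<kappa>\<close> cancel and \<open>\<delta>\<close>
  telescopes.\<close>

lemma euler_of_exact_ranks:
  assumes "\<And>p. \<alpha> p = \<delta> p + \<iota> p" "\<And>p. \<xi> p = \<iota> p + \<kappa> p"
    and "\<And>p. \<rho> p = \<kappa> p + (case p of 0 \<Rightarrow> 0 | Suc q \<Rightarrow> \<delta> q)"
    and "\<forall>p\<ge>N. \<alpha> p = (0::nat)"
  shows "(\<Sum>p<Suc N. (-1) ^ p * int (\<xi> p)) =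
    (\<Sum>p<Suc N. (-1) ^ p * int (\<alpha> p)) + (\<Sum>p<Suc N. (-1) ^ p * int (\<rho> p))"
proof -
  have "(-1) ^ p * int (\<xi> p) + (-1) ^ p * (int (\<delta> p) + (case p of 0 \<Rightarrow> 0 | Suc q \<Rightarrow> int (\<delta> q)))
     = (-1) ^ p * int (\<alpha> p) + (-1) ^ p * int (\<rho> p)" for p
    by (cases p) (simp_all add: assms algebra_simps)
  then have "(\<Sum>p<Suc N. (-1) ^ p * int (\<xi> p)) +
      (\<Sum>p<Suc N. (-1) ^ p * (int (\<delta> p) + (case p of 0 \<Rightarrow> 0 | Suc q \<Rightarrow> int (\<delta> q)))) =
     (\<Sum>p<Suc N. (-1) ^ p * int (\<alpha> p)) + (\<Sum>p<Suc N. (-1) ^ p * int (\<rho> p))"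
    by (simp only: sum.distrib[symmetric])
  moreover have "\<delta> N = 0" using assms(1)[of N] assms(4) by simp
  ultimately show ?thesis
    using alternating_telescope[of "\<lambda>p. int (\<delta> p)" "Suc N"] by simp
qed

text \<open>In degree \<open>0\<close> the boundary map goes to the trivial group in degree \<open>-1\<close>; otherwise its image is a
  kernel by exactness.\<close>

lemma has_rank_boundary_image:
  assumes "\<And>q. has_rank (homology_group (int q) (subtopology X S))
     (kernel (homology_group (int q) (subtopology X S)) (homology_group (int q) X)
       (hom_induced (int q) (subtopology X S) {} X {} id)) (\<delta> q)"
  shows "has_rank (homology_group (int p - 1) (subtopology X S))
    (hom_boundary (int p) X S ` carrier (relative_homology_group (int p) X S))
    (case p of 0 \<Rightarrow> 0 | Suc q \<Rightarrow> \<delta> q)"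
proof (cases p)
  case 0
  have "trivial_group (homology_group (-1) (subtopology X S))" by simp
  then have "hom_boundary 0 X S ` carrier (relative_homology_group 0 X S) \<subseteq> {\<one>\<^bsub>homology_group (-1) (subtopology X S)\<^esub>}"
    using hom_boundary_carrier[of 0 X S] unfolding trivial_group_def by fastforce
  then have "has_rank (homology_group (-1) (subtopology X S)) (hom_boundary 0 X S ` carrier (relative_homology_group 0 X S)) 0"
    by (metis has_rank_subset has_rank_one abelian_homology_group le_zero_eq)
  then show ?thesis using 0 by simp
next
  case (Suc q)
  then show ?thesis using assms[of q] boundary_image[of q X S] by simp
qed

text \<open>Finiteness of the relative ranks comes out as well: the relative group is an extension of a subgroup
  of the homology of \<open>S\<close> by a quotient of the homology of \<open>X\<close>.\<close>

lemma has_relative_euler_diff: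
  assumes "has_euler (subtopology X S) a" "has_euler X x"
  shows "has_relative_euler X S (x - a)"
proof -
  let ?A = "\<lambda>p. homology_group (int p) (subtopology X S)"
  let ?Y = "\<lambda>p. homology_group (int p) X"
  let ?R = "\<lambda>p. relative_homology_group (int p) X S"
  let ?i = "\<lambda>p. hom_induced (int p) (subtopology X S) {} X {} id"
  let ?j = "\<lambda>p. hom_induced (int p) X {} X S id"
  obtain \<alpha> N where \<alpha>: "\<And>p. has_rank (?A p) (carrier (?A p)) (\<alpha> p)" "\<forall>p\<ge>N. \<alpha> p = 0"
     "a = (\<Sum>p<N. (-1) ^ p * int (\<alpha> p))" using assms(1) unfolding has_euler_groups_def by blast
  obtain \<xi> M where \<xi>: "\<And>p. has_rank (?Y p) (carrier (?Y p)) (\<xi> p)" "\<forall>p\<ge>M. \<xi> p = 0"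
     "x = (\<Sum>p<M. (-1) ^ p * int (\<xi> p))" using assms(2) unfolding has_euler_groups_def by blast
  note P = homology_pair_ranks
  have "\<exists>d e. has_rank (?A p) (kernel (?A p) (?Y p) (?i p)) d \<and>
       has_rank (?Y p) (?i p ` carrier (?A p)) e \<and> \<alpha> p = d + e" for p
    by (rule has_rank_split[OF P(6,7,1) \<alpha>(1)[of p]]) blast
  then obtain \<delta> \<iota> where di: "\<And>p. has_rank (?A p) (kernel (?A p) (?Y p) (?i p)) (\<delta> p)"
       "\<And>p. has_rank (?Y p) (?i p ` carrier (?A p)) (\<iota> p)" "\<And>p. \<alpha> p = \<delta> p + \<iota> p"
    by metis
  have "\<exists>k. has_rank (?R p) (?j p ` carrier (?Y p)) k \<and> \<xi> p = \<iota> p + k" for p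
    by (rule has_rank_split[OF P(7)[of p X] P(8)[of p X S] P(2)[of p X S] \<xi>(1)[of p]])
      (use di(2)[of p] P(4)[of p X S] has_rank_unique in metis)
  then obtain \<kappa> where k: "\<And>p. has_rank (?R p) (?j p ` carrier (?Y p)) (\<kappa> p)" "\<And>p. \<xi> p = \<iota> p + \<kappa> p"
    by metis
  let ?\<rho> = "\<lambda>p. \<kappa> p + (case p of 0 \<Rightarrow> 0 | Suc q \<Rightarrow> \<delta> q)"
  have \<rho>: "has_rank (?R p) (carrier (?R p)) (?\<rho> p)" for p
    using has_rank_kernel_image[OF P(8,9,3), of p X S] k(1)[of p] P(5)[of p X S]
       has_rank_boundary_image[OF di(1), of p] by simp
  let ?N = "max N M"
  have 0: "\<kappa> p = 0" "\<delta> p = 0" if "p \<ge> ?N" for p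
    using that \<alpha>(2) \<xi>(2) di(3)[of p] k(2)[of p] by auto
  have "(\<Sum>p<Suc ?N. (-1) ^ p * int (\<xi> p)) =
    (\<Sum>p<Suc ?N. (-1) ^ p * int (\<alpha> p)) + (\<Sum>p<Suc ?N. (-1) ^ p * int (?\<rho> p))"
    by (rule euler_of_exact_ranks[of _ \<delta> \<iota> _ \<kappa>]) (use di(3) k(2) \<alpha>(2) in auto)
  moreover have "(\<Sum>p<Suc ?N. (-1) ^ p * int (\<xi> p)) = x"
    unfolding \<xi>(3) by (rule alternating_sum_extend) (use \<xi>(2) in auto)
  moreover have "(\<Sum>p<Suc ?N. (-1) ^ p * int (\<alpha> p)) = a"
    unfolding \<alpha>(3) by (rule alternating_sum_extend) (use \<alpha>(2) in auto)
  moreover have "\<forall>p\<ge>Suc ?N. ?\<rho> p = 0"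
    using 0 by (auto split: nat.split)
  ultimately show ?thesis
    unfolding has_euler_groups_def using \<rho>
    by (intro exI[of _ ?\<rho>] exI[of _ "Suc ?N"]) auto
qed

text \<open>The converse direction of \<open>has_relative_euler_diff\<close>, where the unknown is the homology of \<open>X\<close>.\<close>

lemma has_euler_add_relative:
  assumes "has_euler (subtopology X S) a" "has_relative_euler X S r"
  shows "has_euler X (a + r)"
proof -
  let ?A = "\<lambda>p. homology_group (int p) (subtopology X S)"
  let ?Y = "\<lambda>p. homology_group (int p) X"
  let ?R = "\<lambda>p. relative_homology_group (int p) X S"
  let ?i = "\<lambda>p. hom_induced (int p) (subtopology X S) {} X {} id"
  let ?j = "\<lambda>p. hom_induced (int p) X {} X S id"
  obtain \<alpha> N where \<alpha>: "\<And>p. has_rank (?A p) (carrier (?A p)) (\<alpha> p)" "\<forall>p\<ge>N. \<alpha> p = 0"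
     "a = (\<Sum>p<N. (-1) ^ p * int (\<alpha> p))" using assms(1) unfolding has_euler_groups_def by blast
  obtain \<rho> M where \<rho>: "\<And>p. has_rank (?R p) (carrier (?R p)) (\<rho> p)" "\<forall>p\<ge>M. \<rho> p = 0"
     "r = (\<Sum>p<M. (-1) ^ p * int (\<rho> p))" using assms(2) unfolding has_euler_groups_def by blast
  note P = homology_pair_ranks
  have "\<exists>d e. has_rank (?A p) (kernel (?A p) (?Y p) (?i p)) d \<and>
       has_rank (?Y p) (?i p ` carrier (?A p)) e \<and> \<alpha> p = d + e" for p
    by (rule has_rank_split[OF P(6,7,1) \<alpha>(1)[of p]]) blast
  then obtain \<delta> \<iota> where di: "\<And>p. has_rank (?A p) (kernel (?A p) (?Y p) (?i p)) (\<delta> p)"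
       "\<And>p. has_rank (?Y p) (?i p ` carrier (?A p)) (\<iota> p)" "\<And>p. \<alpha> p = \<delta> p + \<iota> p"
    by metis
  have "\<exists>k. has_rank (?R p) (?j p ` carrier (?Y p)) k \<and> \<rho> p = k + (case p of 0 \<Rightarrow> 0 | Suc q \<Rightarrow> \<delta> q)" for p
    by (rule has_rank_split[OF P(8,9,3) \<rho>(1)[of p]])
      (use has_rank_boundary_image[OF di(1), of p] P(5)[of p X S] has_rank_unique in metis)
  then obtain \<kappa> where k: "\<And>p. has_rank (?R p) (?j p ` carrier (?Y p)) (\<kappa> p)"
     "\<And>p. \<rho> p = \<kappa> p + (case p of 0 \<Rightarrow> 0 | Suc q \<Rightarrow> \<delta> q)"
    by metis
  let ?\<xi> = "\<lambda>p. \<iota> p + \<kappa> p"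
  have \<xi>: "has_rank (?Y p) (carrier (?Y p)) (?\<xi> p)" for p
    using has_rank_kernel_image[OF P(7,8,2), of p X S] k(1)[of p] P(4)[of p X S] di(2)[of p] by simp
  let ?N = "max N M"
  have 0: "\<kappa> p = 0" "\<iota> p = 0" if "p \<ge> ?N" for p
  proof -
    have "p \<ge> N" "p \<ge> M" using that by auto
    then have "\<alpha> p = 0" "\<rho> p = 0" using \<alpha>(2) \<rho>(2) by blast+
    then show "\<kappa> p = 0" "\<iota> p = 0" using di(3)[of p] k(2)[of p] by simp_all
  qed
  have "(\<Sum>p<Suc ?N. (-1) ^ p * int (?\<xi> p)) =
    (\<Sum>p<Suc ?N. (-1) ^ p * int (\<alpha> p)) + (\<Sum>p<Suc ?N. (-1) ^ p * int (\<rho> p))"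
    by (rule euler_of_exact_ranks[of _ \<delta> \<iota> _ \<kappa>]) (use di(3) k(2) \<alpha>(2) in auto)
  moreover have "(\<Sum>p<Suc ?N. (-1) ^ p * int (\<rho> p)) = r"
    unfolding \<rho>(3) by (rule alternating_sum_extend) (use \<rho>(2) in auto)
  moreover have "(\<Sum>p<Suc ?N. (-1) ^ p * int (\<alpha> p)) = a"
    unfolding \<alpha>(3) by (rule alternating_sum_extend) (use \<alpha>(2) in auto)
  moreover have "\<forall>p\<ge>Suc ?N. ?\<xi> p = 0"
  proof (intro allI impI)
    fix p assume "Suc ?N \<le> p"
    then have "?N \<le> p" by (rule Suc_leD)
    then show "?\<xi> p = 0" using 0[of p] by simp
  qed
  ultimately show ?thesis
    unfolding has_euler_groups_def using \<xi>
    by (intro exI[of _ ?\<xi>] exI[of _ "Suc ?N"]) auto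
qed

text \<open>Excision identifies the relative homology of \<open>(X, T)\<close> with that of \<open>(X - U, T - U)\<close>. The latter is
  known from \<open>X - U\<close> and \<open>T - U\<close>, and together with \<open>T\<close> it determines the Euler characteristic of \<open>X\<close>.\<close>

lemma has_euler_excision:
  assumes "X closure_of U \<subseteq> X interior_of T"
    and "has_euler (subtopology X T) a"
    and "has_euler (subtopology X (topspace X - U)) c"
    and "has_euler (subtopology X (T - U)) d"
  shows "has_euler X (a + c - d)"
proof -
  let ?C = "subtopology X (topspace X - U)"
  let ?T = "topspace X \<inter> T"
  have "X interior_of T = X interior_of ?T" by (rule interior_of_restrict)
  then have "X closure_of U \<subseteq> X interior_of ?T" using assms(1) by (simp only:)
  from is_isoI[OF homology_excision_axiom[OF this Int_lower1]]
  have ex: "relative_homology_group p ?C (?T - U) \<cong> relative_homology_group p X ?T" for p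
    by (simp only: subtopology_topspace)
  have "subtopology ?C (?T - U) = subtopology X (topspace X \<inter> (T - U))"
    unfolding subtopology_subtopology by (rule arg_cong[where f = "subtopology X"]) blast
  then have "subtopology ?C (?T - U) = subtopology X (T - U)"
    by (simp only: subtopology_restrict)
  then have "has_euler (subtopology ?C (?T - U)) d"
    by (simp only: assms(4))
  note rel = has_relative_euler_diff[OF this assms(3)]
  have iso: "relative_homology_group (int p) X ?T \<cong> relative_homology_group (int p) ?C (?T - U)" for p
    by (rule group.iso_sym[OF group_relative_homology_group ex])
  have "has_relative_euler X ?T (c - d)"
    using rel iso abelian_relative_homology_group abelian_relative_homology_group
    by (rule has_euler_groups_iso)
  then have "has_euler X (a + (c - d))"
    using has_euler_add_relative[of X ?T a "c - d"] assms(2)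
    unfolding subtopology_restrict[of X T] by iprover
  then show ?thesis by (simp only: add_diff_eq)
qed

section \<open>The simplex without its barycenter\<close>

definition simplex :: "'v set \<Rightarrow> ('v \<Rightarrow> real) set" where
  "simplex V = {t. (\<forall>v. 0 \<le> t v) \<and> (\<forall>v. v \<notin> V \<longrightarrow> t v = 0) \<and> sum t V = 1}"

definition barycenter :: "'v set \<Rightarrow> 'v \<Rightarrow> real" where
  "barycenter V v = (if v \<in> V then 1 / real (card V) else 0)"

text \<open>The homotopy that pushes the simplex without its barycenter onto its boundary: subtract \<open>s\<close> times
  the smallest weight from all weights and rescale the total to \<open>1\<close>. At \<open>s = 1\<close> some weight becomes
  \<open>0\<close>; on the boundary the smallest weight is \<open>0\<close> and nothing moves. The denominator vanishes exactly if
  \<open>s = 1\<close> and all weights are equal.\<close>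

definition push_out :: "'v set \<Rightarrow> real \<Rightarrow> ('v \<Rightarrow> real) \<Rightarrow> 'v \<Rightarrow> real" where
  "push_out V s t v =
    (if v \<in> V then (t v - s * Min (t ` V)) / (1 - real (card V) * s * Min (t ` V)) else 0)"

lemma barycenter_in_simplex:
  assumes "finite V" "V \<noteq> {}"
  shows "barycenter V \<in> simplex V"
  using assms by (auto simp: simplex_def barycenter_def)

context
  fixes V :: "'v set" and t :: "'v \<Rightarrow> real"
  assumes V: "finite V" "V \<noteq> {}" and t: "t \<in> simplex V"
begin

lemma Min_simplex: "0 \<le> Min (t ` V)" "v \<in> V \<Longrightarrow> Min (t ` V) \<le> t v"
  using V t by (auto simp: simplex_def)

lemma card_Min_simplex:
  shows "real (card V) * Min (t ` V) \<le> 1" "t \<noteq> barycenter V \<Longrightarrow> real (card V) * Min (t ` V) < 1"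
proof -
  have *: "(\<Sum>v\<in>V. t v - Min (t ` V)) = 1 - real (card V) * Min (t ` V)"
    using t by (simp add: sum_subtractf simplex_def)
  moreover have "0 \<le> (\<Sum>v\<in>V. t v - Min (t ` V))"
    using Min_simplex by (intro sum_nonneg) auto
  ultimately show le: "real (card V) * Min (t ` V) \<le> 1" by simp
  assume ne: "t \<noteq> barycenter V"
  have "real (card V) * Min (t ` V) \<noteq> 1"
  proof
    assume 1: "real (card V) * Min (t ` V) = 1"
    then have "(\<Sum>v\<in>V. t v - Min (t ` V)) = 0" using * by simp
    then have eq: "\<forall>v\<in>V. t v - Min (t ` V) = 0"
      using sum_nonneg_eq_0_iff[OF V(1), of "\<lambda>v. t v - Min (t ` V)"] Min_simplex(2) by simp
    have "Min (t ` V) = 1 / real (card V)"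
      using 1 V by (metis card_0_eq nonzero_mult_div_cancel_left of_nat_eq_0_iff)
    then have "t v = barycenter V v" for v
      using eq t by (cases "v \<in> V") (simp_all add: barycenter_def simplex_def)
    then show False using ne by blast
  qed
  with le show "real (card V) * Min (t ` V) < 1" by simp
qed

lemma push_out_denominator:
  assumes "t \<noteq> barycenter V" "0 \<le> (s::real)" "s \<le> 1"
  shows "0 < 1 - real (card V) * s * Min (t ` V)"
proof -
  have "s * (real (card V) * Min (t ` V)) \<le> 1 * (real (card V) * Min (t ` V))"
    using assms Min_simplex(1) by (intro mult_right_mono) auto
  also have "\<dots> < 1" using card_Min_simplex(2)[OF assms(1)] by simp
  finally show ?thesis by (simp only: mult.assoc mult.left_commute[of s] diff_gt_0_iff_gt)
qed

lemma push_out_in_simplex: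
  assumes "t \<noteq> barycenter V" "0 \<le> (s::real)" "s \<le> 1"
  shows "push_out V s t \<in> simplex V"
proof -
  note d = push_out_denominator[OF assms]
  have "s * Min (t ` V) \<le> t v" if "v \<in> V" for v
    using mult_right_mono[of s 1 "Min (t ` V)"] assms Min_simplex(1) Min_simplex(2)[OF that] by auto
  then have "0 \<le> push_out V s t v" for v
    using d by (auto simp: push_out_def)
  moreover have "sum (push_out V s t) V = 1"
  proof -
    have "sum (push_out V s t) V = (\<Sum>v\<in>V. (t v - s * Min (t ` V)) / (1 - real (card V) * s * Min (t ` V)))"
      by (intro sum.cong) (auto simp: push_out_def)
    also have "\<dots> = (\<Sum>v\<in>V. t v - s * Min (t ` V)) / (1 - real (card V) * s * Min (t ` V))"
      by (simp add: sum_divide_distrib)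
    also have "(\<Sum>v\<in>V. t v - s * Min (t ` V)) = 1 - real (card V) * s * Min (t ` V)"
      using t by (simp add: sum_subtractf simplex_def)
    finally show ?thesis using d by simp
  qed
  ultimately show ?thesis by (auto simp: simplex_def push_out_def)
qed

lemma push_out_0: "push_out V 0 t = t"
  using t by (auto simp: push_out_def simplex_def)

lemma push_out_boundary: "Min (t ` V) = 0 \<Longrightarrow> push_out V s t = t"
  using t by (auto simp: push_out_def simplex_def)

lemma push_out_1: "\<exists>v\<in>V. push_out V 1 t v = 0"
proof -
  have "Min (t ` V) \<in> t ` V" using V by (intro Min_in) auto
  then obtain v where "v \<in> V" "t v = Min (t ` V)" by auto
  then show ?thesis by (auto simp: push_out_def)
qed

lemma push_out_not_barycenter:
  assumes "t \<noteq> barycenter V" "0 \<le> (s::real)" "s \<le> 1"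
  shows "push_out V s t \<noteq> barycenter V"
proof
  assume eq: "push_out V s t = barycenter V"
  note d = push_out_denominator[OF assms]
  have n: "real (card V) > 0" using V by (simp add: card_gt_0_iff)
  have "t v = barycenter V v" for v
  proof (cases "v \<in> V")
    case True
    then have "(t v - s * Min (t ` V)) / (1 - real (card V) * s * Min (t ` V)) = 1 / real (card V)"
      using fun_cong[OF eq, of v] by (simp add: push_out_def barycenter_def)
    then have "t v - s * Min (t ` V) = (1 - real (card V) * s * Min (t ` V)) / real (card V)"
      using d by (simp add: divide_eq_eq)
    also have "\<dots> = 1 / real (card V) - s * Min (t ` V)"
      using n by (simp add: diff_divide_distrib)
    finally show ?thesis using True by (simp add: barycenter_def)
  next
    case False
    then show ?thesis using t by (simp add: simplex_def barycenter_def)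
  qed
  then show False using assms(1) by blast
qed

end

lemma continuous_on_Min_image:
  fixes f :: "'a::topological_space \<Rightarrow> 'v \<Rightarrow> real"
  assumes "finite V" "V \<noteq> {}" "\<And>v. v \<in> V \<Longrightarrow> continuous_on A (\<lambda>x. f x v)"
  shows "continuous_on A (\<lambda>x. Min (f x ` V))"
  using assms
proof (induction V rule: finite_ne_induct)
  case (insert v V)
  then show ?case by (auto simp: intro!: continuous_on_min)
qed simp

section \<open>Complexes of simplices in a function space\<close>

text \<open>Cells are sets of coordinates \<open>e\<close>, each attached to a finite set \<open>ends e\<close> of vertices; the
  coordinate \<open>loop v\<close> belongs to the vertex \<open>v\<close> alone and records its weight. For a category the
  coordinates are the maps, and the coordinates of the vertices are the identities. Two cells may have
  the same vertices, as in a \<open>\<Delta>\<close>-complex; the remaining coordinates tell them apart.\<close>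

locale cell_coordinates =
  fixes Ob :: "'v set" and ends :: "'e \<Rightarrow> 'v set" and loop :: "'v \<Rightarrow> 'e"
  assumes ends_loop: "v \<in> Ob \<Longrightarrow> ends (loop v) = {v}"
    and finite_ends: "finite (ends e)"
begin

definition verts :: "'e set \<Rightarrow> 'v set" where
  "verts M = {v \<in> Ob. loop v \<in> M}"

definition is_cell :: "'e set \<Rightarrow> bool" where
  "is_cell M \<longleftrightarrow> finite (verts M) \<and> verts M \<noteq> {} \<and> (\<forall>e\<in>M. ends e \<subseteq> verts M)"

definition face :: "'e set \<Rightarrow> 'v set \<Rightarrow> 'e set" where
  "face M W = {e \<in> M. ends e \<subseteq> W}"

text \<open>The point of the cell \<open>M\<close> with barycentric coordinates \<open>t\<close>. As products, the coordinates vanish as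
  soon as one of their vertices has weight \<open>0\<close>, which glues the cell to its faces (\<open>point_face\<close>).\<close>

definition point :: "'e set \<Rightarrow> ('v \<Rightarrow> real) \<Rightarrow> 'e \<Rightarrow> real" where
  "point M t e = (if e \<in> M then \<Prod>v\<in>ends e. t v else 0)"

definition weight :: "('e \<Rightarrow> real) \<Rightarrow> 'v \<Rightarrow> real" where
  "weight x v = (if v \<in> Ob then x (loop v) else 0)"

definition support :: "('e \<Rightarrow> real) \<Rightarrow> 'e set" where
  "support x = {e. x e \<noteq> 0}"

definition cell :: "'e set \<Rightarrow> ('e \<Rightarrow> real) set" where
  "cell M = point M ` simplex (verts M)"

definition cell_complex :: "'e set set \<Rightarrow> bool" where
  "cell_complex S \<longleftrightarrow> finite S \<and>
    (\<forall>M\<in>S. is_cell M \<and> (\<forall>W. W \<inter> verts M \<noteq> {} \<longrightarrow> face M W \<in> S))"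

definition polyhedron :: "'e set set \<Rightarrow> ('e \<Rightarrow> real) set" where
  "polyhedron S = (\<Union>M\<in>S. cell M)"

lemma verts_face: "verts (face M W) = verts M \<inter> W"
  using ends_loop by (auto simp: verts_def face_def)

lemma face_face: "face (face M W) U = face M (W \<inter> U)"
  by (auto simp: face_def)

lemma face_verts: "is_cell M \<Longrightarrow> verts M \<subseteq> W \<Longrightarrow> face M W = M"
  by (auto simp: face_def is_cell_def)

lemma is_cell_face: "is_cell M \<Longrightarrow> W \<inter> verts M \<noteq> {} \<Longrightarrow> is_cell (face M W)"
  unfolding is_cell_def verts_face by (auto simp: face_def)

lemma weight_point: "t \<in> simplex (verts M) \<Longrightarrow> weight (point M t) = t"
  by (rule ext) (auto simp: weight_def point_def simplex_def verts_def ends_loop)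

lemma support_point: "support (point M t) = face M {v. t v \<noteq> 0}"
  using finite_ends by (auto simp: support_def point_def face_def)

lemma point_face:
  assumes "\<And>v. v \<notin> W \<Longrightarrow> t v = 0"
  shows "point (face M W) t = point M t"
proof
  fix e
  show "point (face M W) t e = point M t e"
  proof (cases "ends e \<subseteq> W")
    case False
    then have "\<exists>v\<in>ends e. t v = 0" using assms by blast
    then have "(\<Prod>v\<in>ends e. t v) = 0" using finite_ends by (intro prod_zero) auto
    then show ?thesis by (simp add: point_def face_def)
  qed (simp add: point_def face_def)
qed

text \<open>The barycentric coordinates of a point of \<open>M\<close> are among its coordinates as a function, and they
  determine it; so the cell is cut out by equations and weak inequalities, and is closed.\<close>

lemma cell_iff: "x \<in> cell M \<longleftrightarrow> weight x \<in> simplex (verts M) \<and> x = point M (weight x)"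
  unfolding cell_def using weight_point by auto

lemma simplex_nonzero:
  assumes "t \<in> simplex V"
  shows "{v. t v \<noteq> 0} \<inter> V \<noteq> {}"
proof
  assume "{v. t v \<noteq> 0} \<inter> V = {}"
  then have "sum t V = 0" by (intro sum.neutral) auto
  then show False using assms by (simp add: simplex_def)
qed

text \<open>The nonzero coordinates of a point form the unique cell that has the point in its interior.\<close>

lemma support_in_complex:
  assumes "cell_complex S" "M \<in> S" "x \<in> cell M"
  shows "support x \<in> S"
proof -
  obtain t where "t \<in> simplex (verts M)" "x = point M t"
    using assms(3) by (auto simp: cell_def)
  then show ?thesis
    using assms simplex_nonzero unfolding cell_complex_def by (metis support_point)
qed

lemma in_cell_support:
  assumes "x \<in> cell M" "is_cell M"
  shows "x \<in> cell (support x)"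
proof -
  obtain t where t: "t \<in> simplex (verts M)" and x: "x = point M t"
    using assms by (auto simp: cell_def)
  let ?W = "{v. t v \<noteq> 0}"
  have "sum t (verts M \<inter> ?W) = sum t (verts M)"
    using assms(2) by (intro sum.mono_neutral_left) (auto simp: is_cell_def)
  then have "t \<in> simplex (verts M \<inter> ?W)" using t by (auto simp: simplex_def)
  moreover have "x = point (face M ?W) t" unfolding x by (rule point_face[symmetric]) auto
  ultimately show ?thesis unfolding x support_point by (auto simp: cell_def verts_face)
qed

lemma cell_face_subset: "is_cell M \<Longrightarrow> cell (face M W) \<subseteq> cell M"
proof
  fix x assume "x \<in> cell (face M W)" and M: "is_cell M"
  then obtain t where t: "t \<in> simplex (verts M \<inter> W)" and x: "x = point (face M W) t"
    by (auto simp: cell_def verts_face)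
  have "sum t (verts M \<inter> W) = sum t (verts M)"
    using M t by (intro sum.mono_neutral_left) (auto simp: is_cell_def simplex_def)
  then have "t \<in> simplex (verts M)" using t by (auto simp: simplex_def)
  moreover have "x = point M t"
    unfolding x using t by (intro point_face) (auto simp: simplex_def)
  ultimately show "x \<in> cell M" by (auto simp: cell_def)
qed

lemma continuous_coordinate: "continuous_on A (\<lambda>x::'e \<Rightarrow> real. x e)"
  by (rule continuous_on_product_then_coordinatewise) (rule continuous_on_id)

lemma continuous_weight: "continuous_on A (\<lambda>x. weight x v)"
  unfolding weight_def by (cases "v \<in> Ob") (auto intro: continuous_coordinate)

lemma continuous_point_weight: "continuous_on A (\<lambda>x. point M (weight x) e)"
  unfolding point_def by (cases "e \<in> M") (simp_all add: continuous_weight continuous_on_prod)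

lemma closed_cell: "closed (cell M)"
proof -
  have "cell M = {x. \<forall>v. 0 \<le> weight x v} \<inter> (\<Inter>v\<in>-verts M. {x. weight x v = 0}) \<inter>
     {x. (\<Sum>v\<in>verts M. weight x v) = 1} \<inter> {x. \<forall>e. x e = point M (weight x) e}"
    by (auto simp: cell_iff simplex_def fun_eq_iff)
  moreover have "closed {x. \<forall>v. 0 \<le> weight x v}"
    by (intro closed_Collect_all closed_Collect_le continuous_weight continuous_on_const)
  moreover have "closed (\<Inter>v\<in>-verts M. {x. weight x v = 0})"
    by (intro closed_INT ballI closed_Collect_eq continuous_weight continuous_on_const)
  moreover have "closed {x. (\<Sum>v\<in>verts M. weight x v) = 1}"
    by (intro closed_Collect_eq continuous_on_sum continuous_weight continuous_on_const)
  moreover have "closed {x. \<forall>e. x e = point M (weight x) e}"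
    by (intro closed_Collect_all closed_Collect_eq continuous_point_weight continuous_coordinate)
  ultimately show ?thesis by (simp only: closed_Int)
qed

lemma closed_polyhedron: "finite S \<Longrightarrow> closed (polyhedron S)"
  unfolding polyhedron_def by (intro closed_UN) (auto simp: closed_cell)

context
  fixes S :: "'e set set" and M :: "'e set"
  assumes S: "cell_complex S" and M: "M \<in> S" and S': "cell_complex (S - {M})"
begin

abbreviation (input) center :: "'e \<Rightarrow> real" where
  "center \<equiv> point M (barycenter (verts M))"

lemma M_cell: "is_cell M" "finite (verts M)" "verts M \<noteq> {}"
  using S M by (auto simp: cell_complex_def is_cell_def)

lemma polyhedron_split: "polyhedron S = cell M \<union> polyhedron (S - {M})"
  using M by (auto simp: polyhedron_def)

text \<open>The points that a cell \<open>M\<close>, not a proper face of any other cell, shares with the rest of the complex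
  are those of its boundary: a point with positive weights has support \<open>M\<close>.\<close>

lemma boundary_iff:
  assumes x: "x \<in> cell M"
  shows "x \<in> polyhedron (S - {M}) \<longleftrightarrow> Min (weight x ` verts M) = 0"
proof
  have t: "weight x \<in> simplex (verts M)" and xp: "x = point M (weight x)"
    using x by (auto simp: cell_iff)
  {
    assume "x \<in> polyhedron (S - {M})"
    then obtain N where "N \<in> S - {M}" "x \<in> cell N" by (auto simp: polyhedron_def)
    then have "support x \<noteq> M" using support_in_complex[OF S'] by blast
    then have "face M {v. weight x v \<noteq> 0} \<noteq> M" using xp support_point by metis
    then obtain v where v: "v \<in> verts M" "weight x v = 0"
      using M_cell(1) unfolding is_cell_def face_def by blast
    then have "Min (weight x ` verts M) \<le> 0" using M_cell by (metis Min_le finite_imageI imageI)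
    then show "Min (weight x ` verts M) = 0"
      using Min_simplex(1)[OF M_cell(2,3) t] by simp
  }
  assume "Min (weight x ` verts M) = 0"
  then obtain v where v: "v \<in> verts M" "weight x v = 0"
    using Min_in[of "weight x ` verts M"] M_cell by auto
  then have "loop v \<in> M" "x (loop v) = 0" by (auto simp: verts_def weight_def)
  then have "support x \<noteq> M" by (auto simp: support_def)
  then have "support x \<in> S - {M}" using support_in_complex[OF S M x] by blast
  then show "x \<in> polyhedron (S - {M})"
    using in_cell_support[OF x M_cell(1)] by (auto simp: polyhedron_def)
qed

lemma center_in_cell: "center \<in> cell M" "weight center = barycenter (verts M)"
  using barycenter_in_simplex[OF M_cell(2,3)] weight_point by (auto simp: cell_def)

lemma center_notin: "center \<notin> polyhedron (S - {M})"
proof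
  assume "center \<in> polyhedron (S - {M})"
  then have "Min (barycenter (verts M) ` verts M) = 0"
    using boundary_iff[OF center_in_cell(1)] center_in_cell(2) by simp
  moreover have "barycenter (verts M) ` verts M = {1 / real (card (verts M))}"
    using M_cell(3) by (auto simp: barycenter_def)
  ultimately show False using M_cell by simp
qed

lemma weight_barycenter_iff:
  assumes "x \<in> cell M" shows "weight x = barycenter (verts M) \<longleftrightarrow> x = center"
  using assms center_in_cell(2) by (metis cell_iff)

text \<open>Moves the points of \<open>M\<close> by \<^const>\<open>push_out\<close> and fixes all others; the pair consists of the time and the
  point.\<close>

definition push_cell :: "real \<times> ('e \<Rightarrow> real) \<Rightarrow> 'e \<Rightarrow> real" where
  "push_cell p = (if snd p \<in> cell M then point M (push_out (verts M) (fst p) (weight (snd p))) else snd p)"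

text \<open>Both branches are continuous on closed pieces, and on the overlap, the boundary of \<open>M\<close>, they
  agree.\<close>

lemma continuous_push_cell:
  "continuous_on ({0..1} \<times> (polyhedron S - {center})) push_cell"
proof -
  let ?A = "{0..1::real} \<times> (cell M - {center})"
  let ?B = "{0..1::real} \<times> polyhedron (S - {M})"
  let ?f = "\<lambda>p. point M (push_out (verts M) (fst p) (weight (snd p)))"
  have un: "?A \<union> ?B = {0..1} \<times> (polyhedron S - {center})"
    using center_notin by (auto simp: polyhedron_split)
  have "closed (UNIV \<times> cell M :: (real \<times> ('e \<Rightarrow> real)) set)"
    by (intro closed_Times closed_cell closed_UNIV)
  moreover have "(?A \<union> ?B) \<inter> (UNIV \<times> cell M) = ?A"
    using center_notin by blast
  ultimately have A: "closedin (top_of_set (?A \<union> ?B)) ?A"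
    using closedin_closed_Int[of "UNIV \<times> cell M" "?A \<union> ?B"] by (simp only:)
  have "closed (UNIV \<times> polyhedron (S - {M}) :: (real \<times> ('e \<Rightarrow> real)) set)"
    using S by (intro closed_Times closed_polyhedron closed_UNIV) (simp add: cell_complex_def)
  moreover have "(?A \<union> ?B) \<inter> (UNIV \<times> polyhedron (S - {M})) = (?A \<inter> UNIV \<times> polyhedron (S - {M})) \<union> ?B"
    by blast
  moreover have "(?A \<inter> UNIV \<times> polyhedron (S - {M})) \<union> ?B = ?B"
    by blast
  ultimately have B: "closedin (top_of_set (?A \<union> ?B)) ?B"
    using closedin_closed_Int[of "UNIV \<times> polyhedron (S - {M})" "?A \<union> ?B"] by (simp only:)
  have w: "continuous_on ?A (\<lambda>p. weight (snd p) v)" for v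
    by (rule continuous_on_compose2[OF continuous_weight[of UNIV] continuous_on_snd[OF continuous_on_id]]) auto
  have m: "continuous_on ?A (\<lambda>p. Min (weight (snd p) ` verts M))"
    by (rule continuous_on_Min_image[OF M_cell(2,3) w])
  have d: "1 - real (card (verts M)) * fst p * Min (weight (snd p) ` verts M) \<noteq> 0" if "p \<in> ?A" for p
  proof -
    have "weight (snd p) \<in> simplex (verts M)" "weight (snd p) \<noteq> barycenter (verts M)"
      using that weight_barycenter_iff[of "snd p"] by (auto simp: cell_iff)
    from push_out_denominator[OF M_cell(2,3) this, of "fst p"] show ?thesis using that by auto
  qed
  have f: "continuous_on ?A ?f"
  proof (rule continuous_on_coordinatewise_then_product)
    fix e
    show "continuous_on ?A (\<lambda>p. ?f p e)"
    proof (cases "e \<in> M")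
      case True
      have "continuous_on ?A (\<lambda>p. push_out (verts M) (fst p) (weight (snd p)) v)" for v
        unfolding push_out_def
      proof (cases "v \<in> verts M")
        case True
        have "continuous_on ?A (\<lambda>p. (weight (snd p) v - fst p * Min (weight (snd p) ` verts M)) /
            (1 - real (card (verts M)) * fst p * Min (weight (snd p) ` verts M)))"
          by (intro continuous_on_divide continuous_on_diff continuous_on_mult w m continuous_on_const
              continuous_on_fst continuous_on_id ballI d)
        with True show "continuous_on ?A (\<lambda>p. if v \<in> verts M then
            (weight (snd p) v - fst p * Min (weight (snd p) ` verts M)) /
            (1 - real (card (verts M)) * fst p * Min (weight (snd p) ` verts M)) else 0)"
          by simp
      qed simp
      then show ?thesis using True by (simp add: point_def continuous_on_prod)
    qed (simp add: point_def)
  qed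
  have "continuous_on (?A \<union> ?B) (\<lambda>p. if snd p \<in> cell M then ?f p else snd p)"
  proof (rule continuous_on_cases_local[OF A B f])
    show "continuous_on ?B snd" by (intro continuous_intros)
    fix p assume "p \<in> ?A \<and> \<not> snd p \<in> cell M \<or> p \<in> ?B \<and> snd p \<in> cell M"
    then have p: "p \<in> ?B" "snd p \<in> cell M" by auto
    then have "Min (weight (snd p) ` verts M) = 0" using boundary_iff by auto
    then show "?f p = snd p"
      using p by (metis cell_iff M_cell(2,3) push_out_boundary)
  qed
  then show ?thesis unfolding un push_cell_def .
qed

lemma push_cell_in:
  assumes "x \<in> polyhedron S - {center}" "0 \<le> s" "s \<le> 1"
  shows "push_cell (s, x) \<in> polyhedron S - {center}"
proof (cases "x \<in> cell M")
  case True
  then have w: "weight x \<in> simplex (verts M)" "weight x \<noteq> barycenter (verts M)"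
    using assms weight_barycenter_iff by (auto simp: cell_iff)
  let ?t = "push_out (verts M) s (weight x)"
  have t: "?t \<in> simplex (verts M)"
    using push_out_in_simplex[OF M_cell(2,3) w] assms by simp
  have "?t \<noteq> barycenter (verts M)"
    using push_out_not_barycenter[OF M_cell(2,3) w] assms by simp
  then have "point M ?t \<noteq> center" using weight_point[OF t] center_in_cell(2) by metis
  moreover have "point M ?t \<in> cell M" using t by (auto simp: cell_def)
  ultimately show ?thesis using True by (simp add: push_cell_def polyhedron_split)
qed (use assms in \<open>auto simp: push_cell_def\<close>)

lemma push_cell_0: "x \<in> polyhedron S \<Longrightarrow> push_cell (0, x) = x"
  using push_out_0[OF M_cell(2,3)] by (auto simp: push_cell_def cell_iff)

lemma push_cell_1:
  assumes "x \<in> polyhedron S - {center}"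
  shows "push_cell (1, x) \<in> polyhedron (S - {M})"
proof (cases "x \<in> cell M")
  case True
  then have w: "weight x \<in> simplex (verts M)" "weight x \<noteq> barycenter (verts M)"
    using assms weight_barycenter_iff by (auto simp: cell_iff)
  let ?t = "push_out (verts M) 1 (weight x)"
  have t: "?t \<in> simplex (verts M)"
    using push_out_in_simplex[OF M_cell(2,3) w] by simp
  obtain v where "v \<in> verts M" "?t v = 0" using push_out_1[OF M_cell(2,3) w(1)] by blast
  then have "Min (?t ` verts M) \<le> 0" using M_cell by (metis Min_le finite_imageI imageI)
  then have "Min (?t ` verts M) = 0" using Min_simplex(1)[OF M_cell(2,3) t] by simp
  then have "point M ?t \<in> polyhedron (S - {M})"
    using t by (subst boundary_iff) (auto simp: cell_def weight_point)
  then show ?thesis using True by (simp add: push_cell_def)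
qed (use assms in \<open>auto simp: push_cell_def polyhedron_split\<close>)

lemma push_cell_fixed:
  assumes "x \<in> polyhedron (S - {M})"
  shows "push_cell (s, x) = x"
proof (cases "x \<in> cell M")
  case True
  then have "Min (weight x ` verts M) = 0" using boundary_iff assms by blast
  then show ?thesis using True push_out_boundary[OF M_cell(2,3)]
    by (auto simp: push_cell_def cell_iff)
qed (simp add: push_cell_def)

lemma punctured_polyhedron_homotopy_equivalent:
  "top_of_set (polyhedron S - {center}) homotopy_equivalent_space top_of_set (polyhedron (S - {M}))"
proof (rule deformation_retract_imp_homotopy_equivalent_space)
  let ?X = "polyhedron S - {center}"
  let ?r = "\<lambda>x. push_cell (1, x)"
  have "homotopic_with (\<lambda>x. True) (top_of_set ?X) (top_of_set ?X) id ?r"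
    by (subst homotopic_with, simp, rule exI[of _ push_cell])
      (use continuous_push_cell push_cell_in push_cell_0 in \<open>auto simp: image_subset_iff Pi_iff\<close>)
  then show "homotopic_with (\<lambda>x. True) (top_of_set ?X) (top_of_set ?X) ?r id"
    by (simp add: homotopic_with_sym)
  have "continuous_on ?X ?r"
    by (rule continuous_on_compose2[OF continuous_push_cell]) (auto intro!: continuous_intros)
  then show "retraction_maps (top_of_set ?X) (top_of_set (polyhedron (S - {M}))) ?r id"
    using push_cell_1 push_cell_fixed center_notin
    by (auto simp: retraction_maps_def image_subset_iff Pi_iff polyhedron_split)
qed

end

definition faces :: "'e set \<Rightarrow> 'e set set" where
  "faces M = face M ` (Pow (verts M) - {{}})"

lemma face_Int_verts: "is_cell M \<Longrightarrow> face M (verts M \<inter> W) = face M W"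
  by (auto simp: is_cell_def face_def)

lemma self_in_faces: "is_cell M \<Longrightarrow> M \<in> faces M"
  using face_verts[of M "verts M"] unfolding faces_def is_cell_def by (intro image_eqI[of _ _ "verts M"]) auto

lemma cell_complex_faces:
  assumes "is_cell M"
  shows "cell_complex (faces M)"
  unfolding cell_complex_def
proof (intro conjI ballI allI impI)
  show "finite (faces M)" using assms by (simp add: faces_def is_cell_def)
  fix N assume "N \<in> faces M"
  then obtain W where W: "W \<subseteq> verts M" "W \<noteq> {}" and N: "N = face M W" by (auto simp: faces_def)
  then have "W \<inter> verts M \<noteq> {}" by auto
  then show "is_cell N" unfolding N using assms by (intro is_cell_face)
  fix U assume "U \<inter> verts N \<noteq> {}"
  then have "W \<inter> U \<in> Pow (verts M) - {{}}" using W by (auto simp: N verts_face)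
  then show "face N U \<in> faces M" unfolding N face_face faces_def by (rule imageI)
qed

lemma faces_subset:
  assumes "cell_complex S" "M \<in> S"
  shows "faces M \<subseteq> S"
  using assms unfolding cell_complex_def faces_def by (auto simp: Int_absorb2)

lemma polyhedron_faces:
  assumes "is_cell M"
  shows "polyhedron (faces M) = cell M"
proof
  show "polyhedron (faces M) \<subseteq> cell M"
    unfolding polyhedron_def faces_def using cell_face_subset[OF assms] by blast
  show "cell M \<subseteq> polyhedron (faces M)"
    unfolding polyhedron_def using self_in_faces[OF assms] by blast
qed

lemma card_verts_faces: "is_cell M \<Longrightarrow> N \<in> faces M \<Longrightarrow> card (verts N) \<le> card (verts M)"
  by (auto simp: faces_def verts_face is_cell_def intro!: card_mono)

text \<open>A cell with the largest number of vertices is not a proper face, so the other cells still contain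
  their faces.\<close>

lemma cell_complex_remove:
  assumes S: "cell_complex S" and "M \<in> S" and max: "\<And>N. N \<in> S \<Longrightarrow> card (verts N) \<le> card (verts M)"
  shows "cell_complex (S - {M})"
  unfolding cell_complex_def
proof (intro conjI ballI allI impI)
  show "finite (S - {M})" using S by (simp add: cell_complex_def)
  fix N assume N: "N \<in> S - {M}"
  then show cN: "is_cell N" using S by (simp add: cell_complex_def)
  fix W assume W: "W \<inter> verts N \<noteq> {}"
  have "face N W \<noteq> M"
  proof
    assume eq: "face N W = M"
    have "card (verts N) \<le> card (verts N \<inter> W)"
      using max[of N] N verts_face[of N W] eq by simp
    then have "verts N \<inter> W = verts N"
      using cN by (intro card_seteq) (auto simp: is_cell_def)
    then have "face N W = N" using face_verts[OF cN, of W] by blast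
    then show False using N eq by simp
  qed
  then show "face N W \<in> S - {M}" using S N W by (auto simp: cell_complex_def)
qed

text \<open>Contract along straight lines to the barycenter, in barycentric coordinates.\<close>

lemma contractible_cell:
  assumes "is_cell M"
  shows "contractible (cell M)"
  unfolding contractible_def
proof
  have V: "finite (verts M)" "verts M \<noteq> {}" using assms by (auto simp: is_cell_def)
  let ?b = "barycenter (verts M)"
  let ?h = "\<lambda>p. point M (\<lambda>v. (1 - fst p) * weight (snd p) v + fst p * ?b v)"
  have w: "continuous_on ({0..1} \<times> cell M) (\<lambda>p. weight (snd p) v)" for v
    by (rule continuous_on_compose2[OF continuous_weight[of UNIV] continuous_on_snd[OF continuous_on_id]]) auto
  have "continuous_on ({0..1} \<times> cell M) (\<lambda>p. ?h p e)" for e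
    unfolding point_def
    by (cases "e \<in> M") (simp_all, intro continuous_on_prod continuous_on_add continuous_on_mult
        continuous_on_diff continuous_on_const continuous_on_fst continuous_on_id w)
  then have h: "continuous_on ({0..1} \<times> cell M) ?h"
    by (rule continuous_on_coordinatewise_then_product)
  have "?h (s, x) \<in> cell M" if "0 \<le> s" "s \<le> 1" "x \<in> cell M" for s x
  proof -
    have "weight x \<in> simplex (verts M)" using that by (simp add: cell_iff)
    then have "(\<lambda>v. (1 - s) * weight x v + s * ?b v) \<in> simplex (verts M)"
      using barycenter_in_simplex[OF V] that
      by (auto simp: simplex_def sum.distrib simp flip: sum_distrib_left)
    then show ?thesis by (simp add: cell_def)
  qed
  moreover have "?h (0, x) = x" if "x \<in> cell M" for x
    using that by (simp add: cell_iff[of x])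
  ultimately show "homotopic_with_canon (\<lambda>x. True) (cell M) (cell M) id (\<lambda>x. point M ?b)"
    using h by (subst homotopic_with, simp, intro exI[of _ ?h]) (auto simp: image_subset_iff Pi_iff)
qed

lemma has_euler_cell:
  assumes "is_cell M"
  shows "has_euler (top_of_set (cell M)) 1"
proof (rule has_euler_contractible)
  show "contractible_space (top_of_set (cell M))"
    using contractible_cell[OF assms] by (simp only: contractible_space_top_of_set)
  have "barycenter (verts M) \<in> simplex (verts M)"
    using assms by (intro barycenter_in_simplex) (auto simp: is_cell_def)
  then have "cell M \<noteq> {}" unfolding cell_def by blast
  then show "topspace (top_of_set (cell M)) \<noteq> {}"
    by (simp only: topspace_euclidean_subtopology not_False_eq_True)
qed

text \<open>Excise the complement of \<open>M\<close> from the pair of the complex and the complex without the barycenter of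
  \<open>M\<close>. What remains is \<open>M\<close>, of Euler characteristic \<open>1\<close>, and \<open>M\<close> without its barycenter, which is
  equivalent to the boundary of \<open>M\<close>.\<close>

lemma has_euler_remove_cell:
  assumes S: "cell_complex S" and M: "M \<in> S" and max: "\<And>N. N \<in> S \<Longrightarrow> card (verts N) \<le> card (verts M)"
    and a: "has_euler (top_of_set (polyhedron (S - {M}))) a"
    and d: "has_euler (top_of_set (polyhedron (faces M - {M}))) d"
  shows "has_euler (top_of_set (polyhedron S)) (a + 1 - d)"
proof -
  have cM: "is_cell M" using S M by (simp add: cell_complex_def)
  have S': "cell_complex (S - {M})" by (rule cell_complex_remove[OF S M max])
  note F = cell_complex_faces[OF cM] self_in_faces[OF cM]
  have F': "cell_complex (faces M - {M})"
    by (rule cell_complex_remove[OF F card_verts_faces[OF cM]])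
  let ?c = "point M (barycenter (verts M))"
  let ?X = "top_of_set (polyhedron S)"
  let ?T = "polyhedron S - {?c}"
  let ?U = "polyhedron S - cell M"
  have c: "?c \<in> cell M" "?c \<notin> polyhedron (S - {M})"
    using center_in_cell(1)[OF S M S'] center_notin[OF S M S'] by auto
  have PS: "polyhedron S = cell M \<union> polyhedron (S - {M})"
    by (rule polyhedron_split[OF S M S'])
  show ?thesis
  proof (rule has_euler_excision[where T = ?T and U = ?U])
    have "closed (polyhedron (S - {M}))"
      using S by (intro closed_polyhedron) (simp add: cell_complex_def)
    then have "closedin ?X (polyhedron (S - {M}))"
      using PS by (intro closed_subset) auto
    moreover have "?U \<subseteq> polyhedron (S - {M})" using PS by blast
    ultimately have "?X closure_of ?U \<subseteq> polyhedron (S - {M})" by (intro closure_of_minimal)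
    also have "\<dots> \<subseteq> ?T" using c PS by blast
    also have "?T = ?X interior_of ?T"
    proof -
      have "{?c} = {x. \<forall>e. x e = ?c e}" by (auto simp: fun_eq_iff)
      moreover have "closed {x. \<forall>e. x e = ?c e}"
        by (intro closed_Collect_all closed_Collect_eq continuous_coordinate continuous_on_const)
      ultimately have "open (- {?c})" by (simp only: open_Compl)
      then have "openin ?X (polyhedron S \<inter> - {?c})" by (rule openin_open_Int)
      then have "openin ?X ?T" by (simp only: Diff_eq)
      then show ?thesis by (simp add: interior_of_openin)
    qed
    finally show "?X closure_of ?U \<subseteq> ?X interior_of ?T" .
    have "subtopology ?X ?T = top_of_set ?T"
      by (simp add: subtopology_subtopology Int_absorb1 Diff_subset)
    then show "has_euler (subtopology ?X ?T) a"
      using has_euler_homotopy_equivalent[OF punctured_polyhedron_homotopy_equivalent[OF S M S'] a] by simp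
    have "polyhedron S \<inter> (polyhedron S - ?U) = cell M" using PS by blast
    then have "subtopology ?X (topspace ?X - ?U) = top_of_set (cell M)"
      by (simp add: subtopology_subtopology)
    then show "has_euler (subtopology ?X (topspace ?X - ?U)) 1"
      by (simp only: has_euler_cell[OF cM])
    have "polyhedron S \<inter> (?T - ?U) = cell M - {?c}" using PS by blast
    then have "subtopology ?X (?T - ?U) = top_of_set (cell M - {?c})"
      by (simp add: subtopology_subtopology)
    moreover have "has_euler (top_of_set (cell M - {?c})) d"
      using has_euler_homotopy_equivalent[OF punctured_polyhedron_homotopy_equivalent[OF F F'] d]
      by (simp add: polyhedron_faces[OF cM])
    ultimately show "has_euler (subtopology ?X (?T - ?U)) d" by simp
  qed
qed

lemma alternating_sum_subsets:
  assumes "finite V" "V \<noteq> {}"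
  shows "(\<Sum>W\<in>Pow V. (-1) ^ card W) = (0::int)"
  using assms
proof (induction V rule: finite_ne_induct)
  case (singleton x)
  then show ?case by (simp add: Pow_insert Pow_empty)
next
  case (insert x V)
  have "(\<Sum>W\<in>insert x ` Pow V. (-1) ^ card W) = (\<Sum>W\<in>Pow V. (-1) ^ card (insert x W) :: int)"
    using insert.hyps by (subst sum.reindex) (auto simp: inj_on_def)
  also have "\<dots> = (\<Sum>W\<in>Pow V. - ((-1) ^ card W))"
  proof (rule sum.cong)
    fix W assume "W \<in> Pow V"
    then have "finite W" "x \<notin> W" using insert.hyps finite_subset by auto
    then show "(-1) ^ card (insert x W) = - ((-1) ^ card W :: int)" by simp
  qed simp
  finally have 1: "(\<Sum>W\<in>insert x ` Pow V. (-1) ^ card W) = (0::int)"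
    using insert.IH by (simp add: sum_negf)
  have "Pow V \<inter> insert x ` Pow V = {}" using insert.hyps by auto
  then show ?case
    unfolding Pow_insert using insert 1 by (subst sum.union_disjoint) auto
qed

text \<open>The faces of \<open>M\<close> correspond to the nonempty sets of its vertices. The exponent \<open>card (verts N) + 1\<close>
  has the parity of the dimension \<open>card (verts N) - 1\<close> and avoids truncated subtraction.\<close>

lemma sum_faces:
  assumes "is_cell M"
  shows "(\<Sum>N\<in>faces M. (-1) ^ (card (verts N) + 1)) = (1::int)"
proof -
  have V: "finite (verts M)" "verts M \<noteq> {}" using assms by (auto simp: is_cell_def)
  have v: "verts (face M W) = W" if "W \<subseteq> verts M" for W
    using that by (auto simp: verts_face)
  have "inj_on (face M) (Pow (verts M) - {{}})"
    by (rule inj_on_inverseI[where g = verts]) (use v in auto)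
  then have "(\<Sum>N\<in>faces M. (-1) ^ (card (verts N) + 1)) =
      (\<Sum>W\<in>Pow (verts M) - {{}}. (-1) ^ (card (verts (face M W)) + 1) :: int)"
    unfolding faces_def by (subst sum.reindex) auto
  also have "\<dots> = (\<Sum>W\<in>Pow (verts M) - {{}}. - ((-1) ^ card W))"
    using v by (intro sum.cong) auto
  also have "\<dots> = - ((\<Sum>W\<in>Pow (verts M). (-1) ^ card W) - 1)"
    using V by (simp add: sum_negf sum_diff1)
  finally show ?thesis using alternating_sum_subsets[OF V] by simp
qed

text \<open>Removing a top cell \<open>M\<close> expresses the complex through the complexes of the other cells and of the
  proper faces of \<open>M\<close>, both of which have fewer cells. This is circular only if the complex
  consists of the faces of \<open>M\<close>; then it is the cell \<open>M\<close>, which is contractible.\<close>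

theorem has_euler_polyhedron:
  assumes "cell_complex S"
  shows "has_euler (top_of_set (polyhedron S)) (\<Sum>M\<in>S. (-1) ^ (card (verts M) + 1))"
  using assms
proof (induction "card S" arbitrary: S rule: less_induct)
  case less
  have fin: "finite S" using less.prems by (simp add: cell_complex_def)
  let ?w = "\<lambda>M. (-1) ^ (card (verts M) + 1) :: int"
  show ?case
  proof (cases "S = {}")
    case True
    then show ?thesis by (simp add: polyhedron_def has_euler_empty)
  next
    case False
    have "Max ((\<lambda>N. card (verts N)) ` S) \<in> (\<lambda>N. card (verts N)) ` S"
      using fin False by (intro Max_in) auto
    then obtain M where M: "M \<in> S" and eq: "card (verts M) = Max ((\<lambda>N. card (verts N)) ` S)"
      by (metis (no_types, lifting) imageE)
    have max: "card (verts N) \<le> card (verts M)" if "N \<in> S" for N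
      unfolding eq using fin that by (intro Max_ge) auto
    have cM: "is_cell M" using less.prems M by (simp add: cell_complex_def)
    note F = cell_complex_faces[OF cM] self_in_faces[OF cM]
    have FS: "faces M \<subseteq> S" using less.prems M by (rule faces_subset)
    show ?thesis
    proof (cases "faces M = S")
      case True
      have P: "polyhedron S = cell M" using polyhedron_faces[OF cM] True by (simp only:)
      have "has_euler (top_of_set (cell M)) 1" by (rule has_euler_cell[OF cM])
      moreover have "sum ?w S = 1" using sum_faces[OF cM] True by (simp only:)
      ultimately show ?thesis by (simp only: P)
    next
      case False
      have 1: "card (S - {M}) < card S" using fin M by (rule card_Diff1_less)
      have "card (faces M - {M}) \<le> card (S - {M})" using FS fin by (intro card_mono) auto
      with 1 have 2: "card (faces M - {M}) < card S" by simp
      have finF: "finite (faces M)" using FS fin finite_subset by blast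
      note a = less.hyps[OF 1 cell_complex_remove[OF less.prems M max]]
      note d = less.hyps[OF 2 cell_complex_remove[OF F card_verts_faces[OF cM]]]
      have "has_euler (top_of_set (polyhedron S)) (sum ?w (S - {M}) + 1 - sum ?w (faces M - {M}))"
        by (rule has_euler_remove_cell[OF less.prems M max a d])
      moreover have "sum ?w (S - {M}) = sum ?w S - ?w M" using fin M by (simp add: sum_diff1)
      moreover have "sum ?w (faces M - {M}) = 1 - ?w M"
        using finF F(2) sum_faces[OF cM] by (simp add: sum_diff1)
      ultimately show ?thesis by simp
    qed
  qed
qed

end

section \<open>Simplices of the nerve\<close>

locale skeletal_endofree_category = category C for C :: "('o, 'm) cat" +
  assumes finite_C: "finite_cat C"
    and skeletal_C: "skeletal C"
    and endofree_C: "no_nontrivial_endomorphisms C"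
begin

lemma endo_is_id: "f \<in> Mor C \<Longrightarrow> Dom C f = Cod C f \<Longrightarrow> f = Id C (Dom C f)"
  using endofree_C by (auto simp: no_nontrivial_endomorphisms_def)

text \<open>The composites in both orders are endomorphisms, hence identities, so that \<open>f\<close> is an isomorphism.\<close>

lemma arrows_antisym:
  assumes f: "f \<in> Mor C" and g: "g \<in> Mor C" and "Cod C f = Dom C g" "Cod C g = Dom C f"
  shows "Dom C f = Cod C f"
proof -
  have "Comp C g f = Id C (Dom C f)"
    using endo_is_id[OF Comp_closed[OF f g]] assms by (simp add: Dom_Comp Cod_Comp)
  moreover have "Comp C f g = Id C (Cod C f)"
    using endo_is_id[OF Comp_closed[OF g f]] assms by (simp add: Dom_Comp Cod_Comp)
  ultimately have "isomorphic_in C (Dom C f) (Cod C f)"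
    unfolding isomorphic_in_def using assms by (intro bexI[of _ f] bexI[of _ g]) auto
  then show ?thesis
    using skeletal_C f by (auto simp: skeletal_def Dom_closed Cod_closed)
qed

abbreviation arrow_ends :: "'m \<Rightarrow> 'o set" where
  "arrow_ends f \<equiv> {Dom C f, Cod C f}"

sublocale cell_coordinates "Obj C" arrow_ends "Id C"
  by unfold_locales (auto simp: Dom_Id Cod_Id)

text \<open>The cell of a simplex of the nerve: all maps of the chain with all their composites, including the
  identities. For degenerate simplices it is the cell of the underlying nondegenerate one.\<close>

definition arrows :: "nat \<Rightarrow> (nat \<Rightarrow> 'o) \<times> (nat \<times> nat \<Rightarrow> 'm) \<Rightarrow> 'm set" where
  "arrows n x = snd x ` {(i, j). i \<le> j \<and> j \<le> n}"

lemma nerve_simplex_iff: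
  "(F, G) \<in> Simp (nerve C) n \<longleftrightarrow>
    (\<forall>i\<in>{..n}. F i \<in> Obj C) \<and> F \<in> extensional {..n} \<and>
    (\<forall>i j. i \<le> j \<and> j \<le> n \<longrightarrow> G (i, j) \<in> Mor C) \<and>
    G \<in> extensional {(i, j). i \<le> j \<and> j \<le> n} \<and>
    (\<forall>i j. i \<le> j \<and> j \<le> n \<longrightarrow> Dom C (G (i, j)) = F i \<and> Cod C (G (i, j)) = F j) \<and>
    (\<forall>i\<in>{..n}. G (i, i) = Id C (F i)) \<and>
    (\<forall>i j. i \<le> j \<and> j \<le> n \<longrightarrow>
      (\<forall>k. j \<le> k \<and> k \<le> n \<longrightarrow> G (i, k) = Comp C (G (j, k)) (G (i, j))))"
  by (simp add: nerve_def functors_def ordinal_cat_def PiE_iff)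

context
  fixes F G n
  assumes x: "(F, G) \<in> Simp (nerve C) n"
begin

lemma simplex_ext: "F \<in> extensional {..n}" "G \<in> extensional {(i, j). i \<le> j \<and> j \<le> n}"
  by (rule x[unfolded nerve_simplex_iff, THEN conjunct2, THEN conjunct1])
    (rule x[unfolded nerve_simplex_iff, THEN conjunct2, THEN conjunct2, THEN conjunct2, THEN conjunct1])

lemma simplex_obj: "i \<le> n \<Longrightarrow> F i \<in> Obj C"
  using x[unfolded nerve_simplex_iff, THEN conjunct1] by blast

lemma simplex_arrow: "i \<le> j \<Longrightarrow> j \<le> n \<Longrightarrow> G (i, j) \<in> Mor C"
  using x[unfolded nerve_simplex_iff, THEN conjunct2, THEN conjunct2, THEN conjunct1] by blast

lemma simplex_dom: "i \<le> j \<Longrightarrow> j \<le> n \<Longrightarrow> Dom C (G (i, j)) = F i"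
  and simplex_cod: "i \<le> j \<Longrightarrow> j \<le> n \<Longrightarrow> Cod C (G (i, j)) = F j"
  using x[unfolded nerve_simplex_iff, THEN conjunct2, THEN conjunct2, THEN conjunct2, THEN conjunct2, THEN conjunct1]
  by blast+

lemma simplex_id: "i \<le> n \<Longrightarrow> G (i, i) = Id C (F i)"
  by (rule x[unfolded nerve_simplex_iff, THEN conjunct2, THEN conjunct2, THEN conjunct2, THEN conjunct2, THEN conjunct2, THEN conjunct1, rule_format]) simp

lemma simplex_comp:
  "i \<le> j \<Longrightarrow> j \<le> k \<Longrightarrow> k \<le> n \<Longrightarrow> G (i, k) = Comp C (G (j, k)) (G (i, j))"
  by (rule x[unfolded nerve_simplex_iff, THEN conjunct2, THEN conjunct2, THEN conjunct2, THEN conjunct2, THEN conjunct2, THEN conjunct2, rule_format]) simp_all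

lemma simplex_extend_right:
  assumes "i \<le> j" "j \<le> l" "l \<le> n" "F j = F l"
  shows "G (i, l) = G (i, j)"
proof -
  have "G (j, l) = Id C (F j)"
    using endo_is_id[OF simplex_arrow[of j l]] assms by (simp add: simplex_dom simplex_cod)
  then show ?thesis
    using simplex_comp[of i j l] Comp_Id_left[of "G (i, j)"] assms
    by (simp add: simplex_arrow simplex_cod)
qed

lemma simplex_extend_left:
  assumes "i \<le> k" "k \<le> l" "l \<le> n" "F i = F k"
  shows "G (i, l) = G (k, l)"
proof -
  have "G (i, k) = Id C (F k)"
    using endo_is_id[OF simplex_arrow[of i k]] assms by (simp add: simplex_dom simplex_cod)
  then show ?thesis
    using simplex_comp[of i k l] Comp_Id_right[of "G (k, l)"] assms
    by (simp add: simplex_arrow simplex_dom)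
qed

text \<open>A stretch of a chain that starts and ends at the same object composes to an identity, so moving the
  ends of \<open>G (i, j)\<close> along such stretches does not change it.\<close>

lemma simplex_arrow_unique:
  assumes "i \<le> j" "j \<le> n" "k \<le> l" "l \<le> n" "F i = F k" "F j = F l"
  shows "G (i, j) = G (k, l)"
proof -
  have *: "G (i, j) = G (k, l)"
    if le: "i \<le> k" "i \<le> j" "j \<le> n" "k \<le> l" "l \<le> n" and F: "F i = F k" "F j = F l" for i j k l
  proof -
    have 1: "G (i, l) = G (k, l)" by (rule simplex_extend_left[OF le(1,4,5) F(1)])
    show ?thesis
    proof (cases "j \<le> l")
      case True
      show ?thesis using simplex_extend_right[OF le(2) True le(5) F(2)] 1 by (rule subst)
    next
      case False
      then have "l \<le> j" by simp
      from simplex_extend_right[OF order_trans[OF le(1,4)] this le(3) F(2)[symmetric]] 1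
      show ?thesis by (rule trans)
    qed
  qed
  show ?thesis
  proof (cases "i \<le> k")
    case True
    then show ?thesis by (rule *[OF _ assms])
  next
    case False
    then have "k \<le> i" by simp
    then show ?thesis by (rule *[OF _ assms(3,4,1,2) assms(5,6)[symmetric], symmetric])
  qed
qed

text \<open>If \<open>j < i\<close>, then there are maps in both directions between \<open>F i\<close> and \<open>F j\<close>, and all maps involved are
  the identity of \<open>F i\<close>.\<close>

lemma arrow_between:
  assumes "k \<le> l" "l \<le> n" "i \<le> n" "j \<le> n" "F i = F k" "F j = F l"
  shows "G (k, l) = (if i \<le> j then G (i, j) else G (i, i))"
proof (cases "i \<le> j")
  case True
  have "G (k, l) = G (i, j)"
    by (rule simplex_arrow_unique[OF assms(1,2) True assms(4) assms(5,6)[symmetric]])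
  then show ?thesis using True by (simp only: if_True)
next
  case False
  then have ji: "j \<le> i" by simp
  have "Dom C (G (k, l)) = Cod C (G (k, l))"
  proof (rule arrows_antisym[OF simplex_arrow[OF assms(1,2)] simplex_arrow[OF ji assms(3)]])
    show "Cod C (G (k, l)) = Dom C (G (j, i))"
      using simplex_cod[OF assms(1,2)] simplex_dom[OF ji assms(3)] assms(6) by (simp only:)
    show "Cod C (G (j, i)) = Dom C (G (k, l))"
      using simplex_dom[OF assms(1,2)] simplex_cod[OF ji assms(3)] assms(5) by (simp only:)
  qed
  then have "F k = F l" using simplex_dom[OF assms(1,2)] simplex_cod[OF assms(1,2)] by (simp only:)
  then have "F l = F i" using assms(5) by (simp only:)
  then have "G (k, l) = G (i, i)"
    by (rule simplex_arrow_unique[OF assms(1,2) le_refl assms(3) assms(5)[symmetric]])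
  then show ?thesis using False by (simp only: if_False)
qed

lemma arrows_subset_Mor: "arrows n (F, G) \<subseteq> Mor C"
  using simplex_arrow by (auto simp: arrows_def)

lemma verts_arrows: "verts (arrows n (F, G)) = F ` {..n}"
proof
  show "verts (arrows n (F, G)) \<subseteq> F ` {..n}"
  proof
    fix v assume "v \<in> verts (arrows n (F, G))"
    then obtain i j where v: "v \<in> Obj C" "Id C v = G (i, j)" "i \<le> j" "j \<le> n"
      by (auto simp: verts_def arrows_def)
    then have "v = F i" using Dom_Id[of v] simplex_dom[of i j] by simp
    then show "v \<in> F ` {..n}" using v by auto
  qed
  show "F ` {..n} \<subseteq> verts (arrows n (F, G))"
  proof
    fix v assume "v \<in> F ` {..n}"
    then obtain i where i: "i \<le> n" "v = F i" by auto
    then have "Id C v = snd (F, G) (i, i)" using simplex_id by simp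
    then show "v \<in> verts (arrows n (F, G))"
      using i simplex_obj by (auto simp: verts_def arrows_def intro!: image_eqI[of _ _ "(i, i)"])
  qed
qed

lemma is_cell_arrows: "is_cell (arrows n (F, G))"
  unfolding is_cell_def verts_arrows by (auto simp: arrows_def simplex_dom simplex_cod)

end

lemma simplex_mapsD:
  assumes "\<theta> \<in> simplex_maps m n"
  shows "i \<le> m \<Longrightarrow> \<theta> i \<le> n" "i \<le> j \<Longrightarrow> j \<le> m \<Longrightarrow> \<theta> i \<le> \<theta> j"
  using assms by (auto simp: simplex_maps_def intro: mono_onD)

lemma Op_nerve:
  "Op (nerve C) m n \<theta> (F, G) =
    (\<lambda>i\<in>{..m}. F (\<theta> i), \<lambda>(i, j)\<in>{(i, j). i \<le> j \<and> j \<le> m}. G (\<theta> i, \<theta> j))"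
  by (simp add: nerve_def ordinal_cat_def)

lemma Op_nerve_closed:
  "\<theta> \<in> simplex_maps m n \<Longrightarrow> x \<in> Simp (nerve C) n \<Longrightarrow> Op (nerve C) m n \<theta> x \<in> Simp (nerve C) m"
  using simplicial_set.Op_closed[OF simplicial_set_nerve] .

text \<open>A map of the chain between two objects that are still present after restriction along \<open>\<theta>\<close> is itself
  still present, because it is determined by its ends.\<close>

lemma arrows_Op:
  assumes x: "(F, G) \<in> Simp (nerve C) n" and \<theta>: "\<theta> \<in> simplex_maps m n"
  shows "arrows m (Op (nerve C) m n \<theta> (F, G)) = face (arrows n (F, G)) (F ` \<theta> ` {..m})"
proof -
  have a: "arrows m (Op (nerve C) m n \<theta> (F, G)) = (\<lambda>(i, j). G (\<theta> i, \<theta> j)) ` {(i, j). i \<le> j \<and> j \<le> m}"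
    unfolding arrows_def Op_nerve by (intro image_cong) auto
  show ?thesis
  proof
    show "arrows m (Op (nerve C) m n \<theta> (F, G)) \<subseteq> face (arrows n (F, G)) (F ` \<theta> ` {..m})"
    proof
      fix f assume "f \<in> arrows m (Op (nerve C) m n \<theta> (F, G))"
      then obtain i j where ij: "i \<le> j" "j \<le> m" "f = G (\<theta> i, \<theta> j)" by (auto simp: a)
      then have "\<theta> i \<le> \<theta> j" "\<theta> j \<le> n" using simplex_mapsD[OF \<theta>] by auto
      then show "f \<in> face (arrows n (F, G)) (F ` \<theta> ` {..m})"
        using ij simplex_dom[OF x] simplex_cod[OF x]
        by (auto simp: face_def arrows_def intro!: image_eqI[of _ _ "(\<theta> i, \<theta> j)"])
    qed
    show "face (arrows n (F, G)) (F ` \<theta> ` {..m}) \<subseteq> arrows m (Op (nerve C) m n \<theta> (F, G))"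
    proof
      fix f assume "f \<in> face (arrows n (F, G)) (F ` \<theta> ` {..m})"
      then obtain k l where kl: "k \<le> l" "l \<le> n" "f = G (k, l)"
        and "Dom C f \<in> F ` \<theta> ` {..m}" "Cod C f \<in> F ` \<theta> ` {..m}"
        by (auto simp: face_def arrows_def)
      then obtain i j where ij: "i \<le> m" "j \<le> m" "F k = F (\<theta> i)" "F l = F (\<theta> j)"
        using simplex_dom[OF x] simplex_cod[OF x] by auto
      have "\<theta> i \<le> n" "\<theta> j \<le> n" using ij simplex_mapsD(1)[OF \<theta>] by blast+
      then have f: "f = (if \<theta> i \<le> \<theta> j then G (\<theta> i, \<theta> j) else G (\<theta> i, \<theta> i))"
        using arrow_between[OF x, of k l "\<theta> i" "\<theta> j"] kl ij by simp
      show "f \<in> arrows m (Op (nerve C) m n \<theta> (F, G))"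
      proof (cases "i \<le> j")
        case True
        then have "\<theta> i \<le> \<theta> j" using ij simplex_mapsD(2)[OF \<theta>] by blast
        then have "f = G (\<theta> i, \<theta> j)" using f by simp
        then show ?thesis using True ij by (auto simp: a intro!: image_eqI[of _ _ "(i, j)"])
      next
        case False
        then have "\<theta> j \<le> \<theta> i" using ij simplex_mapsD(2)[OF \<theta>, of j i] by simp
        then have "f = G (\<theta> i, \<theta> i)" using f by (cases "\<theta> i = \<theta> j") simp_all
        then show ?thesis using ij by (auto simp: a intro!: image_eqI[of _ _ "(i, i)"])
      qed
    qed
  qed
qed

definition nerve_cells :: "'m set set" where
  "nerve_cells = {arrows n x | n x. x \<in> Simp (nerve C) n}"

lemma finite_nerve_cells: "finite nerve_cells"
proof (rule finite_subset)
  show "nerve_cells \<subseteq> Pow (Mor C)"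
    using arrows_subset_Mor by (force simp: nerve_cells_def)
  show "finite (Pow (Mor C))" using finite_C by (simp add: finite_cat_def)
qed

text \<open>A monotone map with prescribed image: round down to the nearest element of \<open>I\<close>, and up to the least
  one where there is none below.\<close>

lemma monotone_map_onto:
  assumes "I \<subseteq> {..n}" "I \<noteq> {}"
  obtains \<theta> where "\<theta> \<in> simplex_maps n n" "\<theta> ` {..n} = I"
proof -
  have fin: "finite I" using assms finite_subset by blast
  let ?J = "\<lambda>i. insert (Min I) {j \<in> I. j \<le> i}"
  let ?\<theta> = "\<lambda>i\<in>{..n}. Max (?J i)"
  have J: "?J i \<subseteq> I" "finite (?J i)" for i using fin assms by auto
  have M: "Max (?J i) \<in> I" for i using Max_in[OF J(2)] J(1) by blast
  have "?\<theta> i = i" if "i \<in> I" for i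
    using that assms fin by (auto intro!: Max_eqI)
  then have "?\<theta> ` {..n} = I" using M assms(1) by force
  moreover have "Max (?J i) \<le> Max (?J j)" if "i \<le> j" for i j
    using that fin by (intro Max_mono) auto
  then have "?\<theta> \<in> simplex_maps n n"
    using M assms(1) by (auto simp: simplex_maps_def intro!: mono_onI)
  ultimately show ?thesis using that by blast
qed

lemma cell_complex_nerve_cells: "cell_complex nerve_cells"
  unfolding cell_complex_def
proof (intro conjI ballI allI impI)
  show "finite nerve_cells" by (rule finite_nerve_cells)
  fix M assume "M \<in> nerve_cells"
  then obtain n F G where M: "M = arrows n (F, G)" and x: "(F, G) \<in> Simp (nerve C) n"
    by (auto simp: nerve_cells_def)
  show cM: "is_cell M" unfolding M by (rule is_cell_arrows[OF x])
  fix W assume "W \<inter> verts M \<noteq> {}"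
  then have "{i \<in> {..n}. F i \<in> W} \<noteq> {}" by (auto simp: M verts_arrows[OF x])
  then obtain \<theta> where \<theta>: "\<theta> \<in> simplex_maps n n" "\<theta> ` {..n} = {i \<in> {..n}. F i \<in> W}"
    using monotone_map_onto[of "{i \<in> {..n}. F i \<in> W}" n] by auto
  have "F ` \<theta> ` {..n} = verts M \<inter> W" unfolding \<theta>(2) M verts_arrows[OF x] by auto
  then have "arrows n (Op (nerve C) n n \<theta> (F, G)) = face M W"
    using arrows_Op[OF x \<theta>(1)] face_Int_verts[OF cM] by (simp add: M)
  moreover have "Op (nerve C) n n \<theta> (F, G) \<in> Simp (nerve C) n"
    by (rule Op_nerve_closed[OF \<theta>(1) x])
  ultimately show "face M W \<in> nerve_cells" unfolding nerve_cells_def by blast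
qed

section \<open>Placing the realization in the function space\<close>

text \<open>The total weight that a point of a simplex puts on the object \<open>v\<close>, which a degenerate simplex may visit
  several times.\<close>

definition mass :: "nat \<Rightarrow> (nat \<Rightarrow> 'o) \<Rightarrow> (nat \<Rightarrow> real) \<Rightarrow> 'o \<Rightarrow> real" where
  "mass n F t v = (\<Sum>i | i \<le> n \<and> F i = v. t i)"

lemma mass_in_simplex:
  assumes "t \<in> standard_simplex n"
  shows "mass n F t \<in> simplex (F ` {..n})"
proof -
  have "0 \<le> mass n F t v" for v
    using assms by (auto simp: mass_def standard_simplex_def intro: sum_nonneg)
  moreover have "mass n F t v = 0" if "v \<notin> F ` {..n}" for v
    unfolding mass_def using that by (intro sum.neutral) auto
  moreover have "sum (mass n F t) (F ` {..n}) = sum t {..n}"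
    unfolding mass_def using sum.image_gen[of "{..n}" t F] by simp
  ultimately show ?thesis using assms by (auto simp: simplex_def standard_simplex_def)
qed

lemma mass_push:
  assumes "\<theta> \<in> simplex_maps m n"
  shows "mass n F (simplex_push m \<theta> t) = mass m (\<lambda>i. F (\<theta> i)) t"
proof
  fix v
  have "mass n F (simplex_push m \<theta> t) v =
      (\<Sum>j | j \<le> n \<and> F j = v. \<Sum>i | i \<in> {i. i \<le> m \<and> F (\<theta> i) = v} \<and> \<theta> i = j. t i)"
    unfolding mass_def simplex_push_def by (intro sum.cong) auto
  also have "\<dots> = (\<Sum>i | i \<le> m \<and> F (\<theta> i) = v. t i)"
    using simplex_mapsD[OF assms] by (intro sum.group) auto
  finally show "mass n F (simplex_push m \<theta> t) v = mass m (\<lambda>i. F (\<theta> i)) t v"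
    by (simp add: mass_def)
qed

lemma mass_cong: "(\<And>i. i \<le> n \<Longrightarrow> F i = F' i) \<Longrightarrow> mass n F t = mass n F' t"
  unfolding mass_def by (intro ext sum.cong) auto

text \<open>The map on the presentation space that induces the homeomorphism of
  \<open>realization_homeomorphic_polyhedron\<close>.\<close>

definition place :: "nat \<times> ((nat \<Rightarrow> 'o) \<times> (nat \<times> nat \<Rightarrow> 'm)) \<times> (nat \<Rightarrow> real) \<Rightarrow> 'm \<Rightarrow> real" where
  "place p = (case p of (n, x, t) \<Rightarrow> point (arrows n x) (mass n (fst x) t))"

text \<open>Pushing weights forward along \<open>\<theta>\<close> does not change the mass of any object, and no mass lies off the
  objects in the image of \<open>\<theta>\<close>; there the cells of \<open>x\<close> and of its restriction agree.\<close>

lemma place_glue: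
  assumes x: "x \<in> Simp (nerve C) n" and \<theta>: "\<theta> \<in> simplex_maps m n"
  shows "place (m, Op (nerve C) m n \<theta> x, t) = place (n, x, simplex_push m \<theta> t)"
proof -
  obtain F G where FG: "x = (F, G)" by (cases x)
  have "mass m (fst (Op (nerve C) m n \<theta> x)) t = mass m (\<lambda>i. F (\<theta> i)) t"
    unfolding FG by (intro mass_cong) (simp add: Op_nerve)
  also have "\<dots> = mass n F (simplex_push m \<theta> t)" by (simp add: mass_push[OF \<theta>])
  finally have m: "mass m (fst (Op (nerve C) m n \<theta> x)) t = mass n F (simplex_push m \<theta> t)" .
  have z: "mass n F (simplex_push m \<theta> t) v = 0" if "v \<notin> F ` \<theta> ` {..m}" for v
    unfolding mass_push[OF \<theta>] unfolding mass_def using that by (intro sum.neutral) auto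
  have "place (m, Op (nerve C) m n \<theta> x, t) = point (face (arrows n x) (F ` \<theta> ` {..m})) (mass n F (simplex_push m \<theta> t))"
    unfolding place_def using arrows_Op[of F G n \<theta> m] x \<theta> m by (simp add: FG)
  also have "\<dots> = point (arrows n x) (mass n F (simplex_push m \<theta> t))"
    by (rule point_face[OF z])
  finally show ?thesis by (simp add: place_def FG)
qed

lemma place_gluing_equiv:
  assumes "(p, q) \<in> gluing_equiv (nerve C)"
  shows "place p = place q"
  using assms unfolding gluing_equiv_def
proof (induction rule: rtrancl_induct)
  case (step q r)
  then have "place q = place r"
    using place_glue by (auto simp: gluing_def)
  with step show ?case by simp
qed simp

lemma topspace_presentation:
  "(n, x, t) \<in> topspace (presentation_space (nerve C)) \<longleftrightarrow> x \<in> Simp (nerve C) n \<and> t \<in> standard_simplex n"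
  by (simp add: presentation_space_def)

lemma simplex_push_in_standard_simplex:
  assumes \<theta>: "\<theta> \<in> simplex_maps m n" and t: "t \<in> standard_simplex m"
  shows "simplex_push m \<theta> t \<in> standard_simplex n"
proof -
  have t0: "0 \<le> t i" and t1: "sum t {..m} = 1" for i using t by (auto simp: standard_simplex_def)
  have pos: "0 \<le> simplex_push m \<theta> t j" for j
    unfolding simplex_push_def using t0 by (intro sum_nonneg) auto
  have le: "simplex_push m \<theta> t j \<le> 1" for j
    unfolding simplex_push_def t1[symmetric] using t0 by (intro sum_mono2) auto
  have "simplex_push m \<theta> t j = 0" if "j > n" for j
  proof -
    have "{i. i \<le> m \<and> \<theta> i = j} = {}" using simplex_mapsD(1)[OF \<theta>] that leD by blast
    then show ?thesis unfolding simplex_push_def by (simp only: sum.empty)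
  qed
  moreover have "sum (simplex_push m \<theta> t) {..n} = sum t {..m}"
    unfolding simplex_push_def using simplex_mapsD(1)[OF \<theta>] sum.group[of "{..m}" "{..n}" \<theta> t] by auto
  ultimately show ?thesis using pos le t1 by (auto simp: standard_simplex_def)
qed

lemma gluing_equiv_trans:
  "(p, q) \<in> gluing_equiv X \<Longrightarrow> (q, r) \<in> gluing_equiv X \<Longrightarrow> (p, r) \<in> gluing_equiv X"
  unfolding gluing_equiv_def by (rule rtrancl_trans)

lemma gluing_equiv_sym: "(p, q) \<in> gluing_equiv X \<Longrightarrow> (q, p) \<in> gluing_equiv X"
proof -
  have "sym (gluing_equiv X)"
    unfolding gluing_equiv_def by (intro sym_rtrancl) (auto simp: sym_def)
  then show "(p, q) \<in> gluing_equiv X \<Longrightarrow> (q, p) \<in> gluing_equiv X" by (rule symD)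
qed

lemma gluing_equivI:
  assumes "\<theta> \<in> simplex_maps m n" "x \<in> Simp X n" "t \<in> standard_simplex m"
  shows "((m, Op X m n \<theta> x, t), (n, x, simplex_push m \<theta> t)) \<in> gluing_equiv X"
  unfolding gluing_equiv_def using assms by (intro r_into_rtrancl UnI1) (auto simp: gluing_def)

text \<open>Points in the interior of a nondegenerate simplex. Every class of the realization contains exactly
  one of them (\<open>reduce_to_normal_form\<close>, \<open>normal_form_unique\<close>).\<close>

definition normal_form :: "nat \<times> ((nat \<Rightarrow> 'o) \<times> (nat \<times> nat \<Rightarrow> 'm)) \<times> (nat \<Rightarrow> real) \<Rightarrow> bool" where
  "normal_form p = (case p of (n, x, t) \<Rightarrow> x \<in> Simp (nerve C) n \<and> t \<in> standard_simplex n \<and>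
     inj_on (fst x) {..n} \<and> (\<forall>i\<le>n. 0 < t i))"

text \<open>The face map \<open>[n] \<rightarrow> [n + 1]\<close> that omits \<open>i\<close>.\<close>

definition skip :: "nat \<Rightarrow> nat \<Rightarrow> nat \<Rightarrow> nat" where
  "skip n i = (\<lambda>k\<in>{..n}. if k < i then k else Suc k)"

text \<open>The degeneracy map \<open>[n + 1] \<rightarrow> [n]\<close> that takes the value \<open>i\<close> at \<open>i\<close> and at \<open>i + 1\<close>.\<close>

definition repeat :: "nat \<Rightarrow> nat \<Rightarrow> nat \<Rightarrow> nat" where
  "repeat n i = (\<lambda>k\<in>{..Suc n}. if k \<le> i then k else k - 1)"

lemma skip_simplex_map: "skip n i \<in> simplex_maps n (Suc n)"
  by (auto simp: skip_def simplex_maps_def intro!: mono_onI)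

lemma repeat_simplex_map: "i \<le> n \<Longrightarrow> repeat n i \<in> simplex_maps (Suc n) n"
  by (auto simp: repeat_def simplex_maps_def intro!: mono_onI)

lemma drop_zero_weight:
  assumes t: "t \<in> standard_simplex (Suc n)" and i: "i \<le> Suc n" "t i = 0"
  defines "u \<equiv> \<lambda>k. if k \<le> n then t (skip n i k) else 0"
  shows "u \<in> standard_simplex n" "simplex_push n (skip n i) u = t"
proof -
  have inj: "inj_on (skip n i) {..n}" by (auto simp: skip_def inj_on_def split: if_splits)
  have img: "skip n i ` {..n} = {..Suc n} - {i}"
  proof
    show "skip n i ` {..n} \<subseteq> {..Suc n} - {i}" by (auto simp: skip_def)
    show "{..Suc n} - {i} \<subseteq> skip n i ` {..n}"
    proof
      fix j assume j: "j \<in> {..Suc n} - {i}"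
      show "j \<in> skip n i ` {..n}"
      proof (cases "j < i")
        case True
        then show ?thesis using i by (intro image_eqI[of _ _ j]) (auto simp: skip_def)
      next
        case False
        then show ?thesis using j by (intro image_eqI[of _ _ "j - 1"]) (auto simp: skip_def)
      qed
    qed
  qed
  have "sum u {..n} = (\<Sum>k\<le>n. t (skip n i k))" by (intro sum.cong) (auto simp: u_def)
  also have "\<dots> = sum t (skip n i ` {..n})" using inj by (simp add: sum.reindex)
  also have "\<dots> = sum t {..Suc n}" unfolding img using i by (simp add: sum_diff1 del: sum.atMost_Suc)
  finally have "sum u {..n} = 1" using t by (simp add: standard_simplex_def del: sum.atMost_Suc)
  then show "u \<in> standard_simplex n" using t by (auto simp: standard_simplex_def u_def)
  show "simplex_push n (skip n i) u = t"
  proof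
    fix j
    show "simplex_push n (skip n i) u j = t j"
    proof (cases "j \<in> skip n i ` {..n}")
      case True
      then obtain k where k: "k \<le> n" "j = skip n i k" by auto
      then have "{l. l \<le> n \<and> skip n i l = j} = {k}" using inj by (auto simp: inj_on_def)
      then show ?thesis using k by (simp add: simplex_push_def u_def)
    next
      case False
      then have "simplex_push n (skip n i) u j = 0" 
        unfolding simplex_push_def by (intro sum.neutral) auto
      moreover have "t j = 0" using False t i unfolding img by (auto simp: standard_simplex_def not_le)
      ultimately show ?thesis by simp
    qed
  qed
qed

text \<open>If an object recurs, then the chain leaves it by a map \<open>F i \<rightarrow> F (i + 1)\<close> from whose target it comes
  back, so \<open>F (i + 1) = F i\<close>.\<close>

lemma repeated_vertex:
  assumes x: "(F, G) \<in> Simp (nerve C) n" and "\<not> inj_on F {..n}"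
  obtains i where "Suc i \<le> n" "F i = F (Suc i)"
proof -
  obtain i j where ij: "i < j" "j \<le> n" "F i = F j"
    using assms(2) by (auto simp: inj_on_def) (metis linorder_neqE_nat)
  have "Dom C (G (i, Suc i)) = Cod C (G (i, Suc i))"
    using arrows_antisym[of "G (i, Suc i)" "G (Suc i, j)"] ij
    by (simp add: simplex_arrow[OF x] simplex_dom[OF x] simplex_cod[OF x])
  then have "F i = F (Suc i)" using ij by (simp add: simplex_dom[OF x] simplex_cod[OF x])
  then show ?thesis using that[of i] ij by simp
qed

lemma degenerate_at_repetition:
  assumes x: "(F, G) \<in> Simp (nerve C) (Suc n)" and i: "i \<le> n" "F i = F (Suc i)"
  shows "Op (nerve C) (Suc n) n (repeat n i) (Op (nerve C) n (Suc n) (skip n (Suc i)) (F, G)) = (F, G)"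
proof -
  let ?s = "\<lambda>k. skip n (Suc i) (repeat n i k)"
  have s: "?s k = (if k = Suc i then i else k)" if "k \<le> Suc n" for k
    using that i by (auto simp: skip_def repeat_def)
  have sF: "F (?s k) = F k" if "k \<le> Suc n" for k using s[OF that] i by simp
  have sle: "?s k \<le> ?s l" "?s l \<le> Suc n" if "k \<le> l" "l \<le> Suc n" for k l
    using s[of k] s[of l] that by (auto split: if_splits)
  have r: "repeat n i k \<le> n" "repeat n i k \<le> repeat n i l" if "k \<le> l" "l \<le> Suc n" for k l
    using that i by (auto simp: repeat_def)
  have "(\<lambda>k\<in>{..Suc n}. F (?s k)) = F"
    using simplex_ext(1)[OF x] sF by (intro extensionalityI[of _ "{..Suc n}"]) auto
  moreover have "(\<lambda>(k, l)\<in>{(k, l). k \<le> l \<and> l \<le> Suc n}. G (?s k, ?s l)) = G"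
  proof (rule extensionalityI[OF _ simplex_ext(2)[OF x]])
    fix p assume "p \<in> {(k, l). k \<le> l \<and> l \<le> Suc n}"
    then obtain k l where kl: "p = (k, l)" "k \<le> l" "l \<le> Suc n" by auto
    have "G (?s k, ?s l) = G (k, l)"
      using kl sle sF by (intro simplex_arrow_unique[OF x]) auto
    then show "(\<lambda>(k, l)\<in>{(k, l). k \<le> l \<and> l \<le> Suc n}. G (?s k, ?s l)) p = G p"
      using kl by simp
  qed simp
  moreover have "Op (nerve C) (Suc n) n (repeat n i) (Op (nerve C) n (Suc n) (skip n (Suc i)) (F, G)) =
    (\<lambda>k\<in>{..Suc n}. F (?s k), \<lambda>(k, l)\<in>{(k, l). k \<le> l \<and> l \<le> Suc n}. G (?s k, ?s l))"
    unfolding Op_nerve using r by (auto simp: fun_eq_iff restrict_def)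
  ultimately show ?thesis by simp
qed

text \<open>As long as a weight is \<open>0\<close> or an object repeats, the point also lies in a simplex of smaller
  dimension: in a face, or in the simplex of which this one is a degeneracy.\<close>

lemma reduce_to_normal_form:
  assumes "x \<in> Simp (nerve C) n" "t \<in> standard_simplex n"
  shows "\<exists>q. normal_form q \<and> ((n, x, t), q) \<in> gluing_equiv (nerve C)"
  using assms
proof (induction n arbitrary: x t)
  case 0
  have "normal_form (0, x, t)"
    using 0 by (simp add: normal_form_def standard_simplex_0)
  moreover have "((0, x, t), (0, x, t)) \<in> gluing_equiv (nerve C)" by (simp add: gluing_equiv_def)
  ultimately show ?case by blast
next
  case (Suc n)
  obtain F G where FG: "x = (F, G)" by (cases x)
  note x = Suc.prems(1)[unfolded FG]
  show ?case
  proof (cases "\<exists>i\<le>Suc n. t i = 0")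
    case True
    then obtain i where i: "i \<le> Suc n" "t i = 0" by blast
    let ?u = "\<lambda>k. if k \<le> n then t (skip n i k) else 0"
    let ?y = "Op (nerve C) n (Suc n) (skip n i) x"
    note u = drop_zero_weight[OF Suc.prems(2) i]
    have "((n, ?y, ?u), (Suc n, x, t)) \<in> gluing_equiv (nerve C)"
      using gluing_equivI[OF skip_simplex_map Suc.prems(1) u(1), of i] u(2) by simp
    moreover obtain q where "normal_form q" "((n, ?y, ?u), q) \<in> gluing_equiv (nerve C)"
      using Suc.IH[OF Op_nerve_closed[OF skip_simplex_map Suc.prems(1)] u(1)] by blast
    ultimately show ?thesis by (meson gluing_equiv_sym gluing_equiv_trans)
  next
    case False
    then have pos: "\<forall>i\<le>Suc n. 0 < t i"
      using Suc.prems(2) by (auto simp: standard_simplex_def less_le)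
    show ?thesis
    proof (cases "inj_on F {..Suc n}")
      case True
      then have "normal_form (Suc n, x, t)"
        using pos Suc.prems by (simp add: normal_form_def FG)
      moreover have "((Suc n, x, t), (Suc n, x, t)) \<in> gluing_equiv (nerve C)" by (simp add: gluing_equiv_def)
      ultimately show ?thesis by blast
    next
      case False
      then obtain i where i: "i \<le> n" "F i = F (Suc i)" using repeated_vertex[OF x] by auto
      let ?y = "Op (nerve C) n (Suc n) (skip n (Suc i)) x"
      let ?u = "simplex_push (Suc n) (repeat n i) t"
      have y: "?y \<in> Simp (nerve C) n" by (rule Op_nerve_closed[OF skip_simplex_map Suc.prems(1)])
      have "Op (nerve C) (Suc n) n (repeat n i) ?y = x"
        unfolding FG by (rule degenerate_at_repetition[OF x i])
      then have "((Suc n, x, t), (n, ?y, ?u)) \<in> gluing_equiv (nerve C)"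
        using gluing_equivI[OF repeat_simplex_map[OF i(1)] y Suc.prems(2)] by simp
      moreover have "?u \<in> standard_simplex n"
        by (rule simplex_push_in_standard_simplex[OF repeat_simplex_map[OF i(1)] Suc.prems(2)])
      then obtain q where "normal_form q" "((n, ?y, ?u), q) \<in> gluing_equiv (nerve C)"
        using Suc.IH[OF y] by blast
      ultimately show ?thesis by (meson gluing_equiv_trans)
    qed
  qed
qed

text \<open>The position of an object in a nondegenerate chain can be read off the maps of the chain: \<open>F i\<close>
  receives maps from exactly \<open>i + 1\<close> objects.\<close>

lemma chain_order:
  assumes x: "(F, G) \<in> Simp (nerve C) n" and inj: "inj_on F {..n}" and i: "i \<le> n"
  shows "{v. \<exists>f\<in>arrows n (F, G). Dom C f = v \<and> Cod C f = F i} = F ` {..i}"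
proof
  show "{v. \<exists>f\<in>arrows n (F, G). Dom C f = v \<and> Cod C f = F i} \<subseteq> F ` {..i}"
  proof
    fix v assume "v \<in> {v. \<exists>f\<in>arrows n (F, G). Dom C f = v \<and> Cod C f = F i}"
    then obtain k l where kl: "k \<le> l" "l \<le> n" "v = F k" "F l = F i"
      by (auto simp: arrows_def simplex_dom[OF x] simplex_cod[OF x])
    then have "l = i" using inj i by (auto simp: inj_on_def)
    then show "v \<in> F ` {..i}" using kl by auto
  qed
  show "F ` {..i} \<subseteq> {v. \<exists>f\<in>arrows n (F, G). Dom C f = v \<and> Cod C f = F i}"
  proof
    fix v assume "v \<in> F ` {..i}"
    then obtain j where j: "j \<le> i" "v = F j" by auto
    then have "G (j, i) \<in> arrows n (F, G)"
      using i by (auto simp: arrows_def intro!: image_eqI[of _ _ "(j, i)"])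
    then show "v \<in> {v. \<exists>f\<in>arrows n (F, G). Dom C f = v \<and> Cod C f = F i}"
      using j i simplex_dom[OF x, of j i] simplex_cod[OF x, of j i] by blast
  qed
qed

lemma nondegenerate_determined_by_arrows:
  assumes x: "x \<in> Simp (nerve C) n" "inj_on (fst x) {..n}"
    and y: "y \<in> Simp (nerve C) m" "inj_on (fst y) {..m}"
    and eq: "arrows n x = arrows m y"
  shows "n = m \<and> x = y"
proof -
  obtain F G F' G' where xy: "x = (F, G)" "y = (F', G')" by (cases x, cases y)
  note x' = x(1)[unfolded xy] and y' = y(1)[unfolded xy]
  have inj: "inj_on F {..n}" "inj_on F' {..m}" using x y by (simp_all add: xy)
  have V: "F ` {..n} = F' ` {..m}"
    using eq verts_arrows[OF x'] verts_arrows[OF y'] by (simp add: xy)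
  then have "card {..n} = card {..m}" using card_image[OF inj(1)] card_image[OF inj(2)] by simp
  then have nm: "n = m" by simp
  have same: "i = k" if "i \<le> n" "k \<le> n" "F i = F' k" for i k
  proof -
    have "F ` {..i} = F' ` {..k}"
      using chain_order[OF x' inj(1) that(1)] chain_order[OF y' inj(2), of k] that nm eq
      by (simp add: xy)
    moreover have "card (F ` {..i}) = Suc i"
      using card_image[OF inj_on_subset[OF inj(1)], of "{..i}"] that by simp
    moreover have "card (F' ` {..k}) = Suc k"
      using card_image[OF inj_on_subset[OF inj(2)], of "{..k}"] that nm by simp
    ultimately show ?thesis by simp
  qed
  have F: "F i = F' i" if i: "i \<le> n" for i
  proof -
    have "F i \<in> F' ` {..n}" using V i nm by blast
    then obtain k where "k \<le> n" "F i = F' k" by auto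
    then show ?thesis using same[of i k] i by simp
  qed
  have G: "G (i, j) = G' (i, j)" if ij: "i \<le> j" "j \<le> n" for i j
  proof -
    have "G (i, j) \<in> arrows n x" using ij by (auto simp: arrows_def xy intro!: image_eqI[of _ _ "(i, j)"])
    then obtain k l where kl: "k \<le> l" "l \<le> n" "G (i, j) = G' (k, l)"
      unfolding eq using nm by (auto simp: arrows_def xy)
    have "F i = F' k" "F j = F' l"
      using kl ij nm simplex_dom[OF x', of i j] simplex_cod[OF x', of i j]
        simplex_dom[OF y', of k l] simplex_cod[OF y', of k l] by simp_all
    then show ?thesis using same[of i k] same[of j l] kl ij by simp
  qed
  have "F = F'"
    using simplex_ext(1)[OF x'] simplex_ext(1)[OF y'] F nm by (intro extensionalityI[of _ "{..n}"]) auto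
  moreover have "G = G'"
    using simplex_ext(2)[OF x'] simplex_ext(2)[OF y'] G nm
    by (intro extensionalityI[of _ "{(i, j). i \<le> j \<and> j \<le> n}"]) auto
  ultimately show ?thesis using nm xy by simp
qed

lemma mass_inj:
  assumes "inj_on F {..n}" "i \<le> n"
  shows "mass n F t (F i) = t i"
proof -
  have "{j. j \<le> n \<and> F j = F i} = {i}" using assms by (auto simp: inj_on_def)
  then show ?thesis by (simp add: mass_def)
qed

lemma support_place:
  assumes x: "x \<in> Simp (nerve C) n" and t: "\<And>i. i \<le> n \<Longrightarrow> mass n (fst x) t (fst x i) \<noteq> 0"
  shows "support (place (n, x, t)) = arrows n x"
proof -
  obtain F G where FG: "x = (F, G)" by (cases x)
  have "support (place (n, x, t)) = face (arrows n x) {v. mass n F t v \<noteq> 0}"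
    by (simp add: place_def support_point FG)
  also have "\<dots> = arrows n x"
    unfolding FG using x t by (intro face_verts is_cell_arrows) (auto simp: FG verts_arrows)
  finally show ?thesis .
qed

lemma support_normal_form:
  assumes "normal_form (n, x, t)"
  shows "support (place (n, x, t)) = arrows n x"
  using assms by (intro support_place) (auto simp: normal_form_def mass_inj less_le)

lemma weight_place:
  assumes "x \<in> Simp (nerve C) n" "t \<in> standard_simplex n"
  shows "weight (place (n, x, t)) = mass n (fst x) t"
proof -
  obtain F G where FG: "x = (F, G)" by (cases x)
  show ?thesis
    unfolding place_def using assms mass_in_simplex[OF assms(2), of F]
    by (simp add: FG weight_point verts_arrows)
qed

text \<open>The support of the image recovers the chain, and the vertex coordinates recover the weights.\<close>

lemma normal_form_unique:
  assumes p: "normal_form p" and q: "normal_form q" and eq: "place p = place q"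
  shows "p = q"
proof -
  obtain n x t m y s where pq: "p = (n, x, t)" "q = (m, y, s)" by (cases p, cases q)
  note p' = p[unfolded pq] and q' = q[unfolded pq]
  have P: "x \<in> Simp (nerve C) n" "t \<in> standard_simplex n" "inj_on (fst x) {..n}"
    and Q: "y \<in> Simp (nerve C) m" "s \<in> standard_simplex m" "inj_on (fst y) {..m}"
    using p' q' by (simp_all add: normal_form_def)
  have "arrows n x = arrows m y"
    using support_normal_form[OF p'] support_normal_form[OF q'] eq pq by simp
  then have nm: "n = m" "x = y"
    using nondegenerate_determined_by_arrows[OF P(1,3) Q(1,3)] by simp_all
  have m: "mass n (fst x) t = mass n (fst x) s"
    using weight_place[OF P(1,2)] weight_place[OF Q(1,2)] eq pq nm by simp
  have "t i = s i" for i
  proof (cases "i \<le> n")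
    case True
    then show ?thesis using mass_inj[OF P(3) True, of t] mass_inj[OF P(3) True, of s] m by simp
  next
    case False
    then show ?thesis using P(2) Q(2) nm by (simp add: standard_simplex_def)
  qed
  then show ?thesis using pq nm by auto
qed

lemma place_inj:
  assumes "p \<in> topspace (presentation_space (nerve C))" "q \<in> topspace (presentation_space (nerve C))"
    and "place p = place q"
  shows "(p, q) \<in> gluing_equiv (nerve C)"
proof -
  obtain n x t m y s where pq: "p = (n, x, t)" "q = (m, y, s)" by (cases p, cases q)
  obtain p' where p': "normal_form p'" "(p, p') \<in> gluing_equiv (nerve C)"
    using reduce_to_normal_form[of x n t] assms(1) by (auto simp: pq topspace_presentation)
  obtain q' where q': "normal_form q'" "(q, q') \<in> gluing_equiv (nerve C)"
    using reduce_to_normal_form[of y m s] assms(2) by (auto simp: pq topspace_presentation)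
  have "p' = q'"
    using normal_form_unique[OF p'(1) q'(1)] place_gluing_equiv[OF p'(2)] place_gluing_equiv[OF q'(2)]
      assms(3) by simp
  then have "(q, p') \<in> gluing_equiv (nerve C)" using q'(2) by (simp only:)
  from p'(2) gluing_equiv_sym[OF this] show ?thesis by (rule gluing_equiv_trans)
qed

lemma place_image:
  "place ` topspace (presentation_space (nerve C)) = polyhedron nerve_cells"
proof
  show "place ` topspace (presentation_space (nerve C)) \<subseteq> polyhedron nerve_cells"
  proof
    fix z assume "z \<in> place ` topspace (presentation_space (nerve C))"
    then obtain p where p: "z = place p" "p \<in> topspace (presentation_space (nerve C))" by blast
    obtain n x t where nxt: "p = (n, x, t)" by (cases p)
    have z: "z = place (n, x, t)" using p nxt by (simp only:)
    have "(n, x, t) \<in> topspace (presentation_space (nerve C))" using p nxt by (simp only:)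
    then have x: "x \<in> Simp (nerve C) n" and t: "t \<in> standard_simplex n" by (simp_all add: topspace_presentation)
    obtain F G where FG: "x = (F, G)" by (cases x)
    have "z \<in> cell (arrows n x)"
      unfolding z place_def cell_def using x mass_in_simplex[OF t, of F] by (simp add: FG verts_arrows)
    moreover have "arrows n x \<in> nerve_cells" using x unfolding nerve_cells_def by blast
    ultimately show "z \<in> polyhedron nerve_cells" unfolding polyhedron_def by (rule UN_I[rotated])
  qed
  show "polyhedron nerve_cells \<subseteq> place ` topspace (presentation_space (nerve C))"
  proof
    fix z assume "z \<in> polyhedron nerve_cells"
    then obtain n F G s where x: "(F, G) \<in> Simp (nerve C) n" and s: "s \<in> simplex (F ` {..n})"
      and z: "z = point (arrows n (F, G)) s"
      by (auto simp: polyhedron_def nerve_cells_def cell_def verts_arrows)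
    \<comment> \<open>A degenerate simplex visits an object several times; all its weight is put on one visit.\<close>
    define r where "r v = (SOME i. i \<le> n \<and> F i = v)" for v
    have r: "r v \<le> n" "F (r v) = v" if "v \<in> F ` {..n}" for v
      using someI_ex[of "\<lambda>i. i \<le> n \<and> F i = v"] that unfolding r_def by auto
    define t where "t i = (if i \<le> n \<and> r (F i) = i then s (F i) else 0)" for i
    have m: "mass n F t = s"
    proof
      fix v show "mass n F t v = s v"
      proof (cases "v \<in> F ` {..n}")
        case True
        have "mass n F t v = (\<Sum>i\<in>{r v}. t i)"
          unfolding mass_def using r[OF True] by (intro sum.mono_neutral_right) (auto simp: t_def)
        then show ?thesis using r[OF True] by (simp add: t_def)
      next
        case False
        then have "mass n F t v = 0" unfolding mass_def by (intro sum.neutral) auto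
        then show ?thesis using s False by (simp add: simplex_def)
      qed
    qed
    have t0: "0 \<le> t i" for i using s by (auto simp: t_def simplex_def)
    have t1: "sum t {..n} = 1"
    proof -
      have "sum t {..n} = sum (mass n F t) (F ` {..n})"
        unfolding mass_def using sum.image_gen[of "{..n}" t F] by simp
      then show ?thesis using s by (simp add: m simplex_def)
    qed
    have "t i \<le> 1" for i
    proof (cases "i \<le> n")
      case True
      then show ?thesis using t1 t0 member_le_sum[of i "{..n}" t] by simp
    qed (simp add: t_def)
    then have "t \<in> standard_simplex n" using t0 t1 by (auto simp: standard_simplex_def t_def)
    then have "(n, (F, G), t) \<in> topspace (presentation_space (nerve C))"
      using x by (simp add: topspace_presentation)
    moreover have "z = place (n, (F, G), t)" by (simp add: place_def m z)
    ultimately show "z \<in> place ` topspace (presentation_space (nerve C))" by blast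
  qed
qed

end

section \<open>The realization as a complex of simplices\<close>

lemma continuous_map_from_sum_topology:
  assumes "\<And>i. i \<in> I \<Longrightarrow> continuous_map (X i) Y (\<lambda>x. f (i, x))"
  shows "continuous_map (sum_topology X I) Y f"
  unfolding continuous_map
proof (intro conjI allI impI)
  show "f ` topspace (sum_topology X I) \<subseteq> topspace Y"
  proof
    fix y assume "y \<in> f ` topspace (sum_topology X I)"
    then obtain i x where "i \<in> I" "x \<in> topspace (X i)" "y = f (i, x)" by auto
    then show "y \<in> topspace Y"
      using continuous_map_image_subset_topspace[OF assms[of i]] by blast
  qed
  fix U assume U: "openin Y U"
  have "openin (X i) {x. (i, x) \<in> {p \<in> topspace (sum_topology X I). f p \<in> U}}" if i: "i \<in> I" for i
  proof -
    have "{x. (i, x) \<in> {p \<in> topspace (sum_topology X I). f p \<in> U}} = {x \<in> topspace (X i). f (i, x) \<in> U}"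
      using i by auto
    then show ?thesis using openin_continuous_map_preimage[OF assms[OF i] U] by simp
  qed
  then show "openin (sum_topology X I) {p \<in> topspace (sum_topology X I). f p \<in> U}"
    by (auto simp: openin_sum_topology)
qed

lemma continuous_map_from_discrete_prod:
  assumes "\<And>x. x \<in> D \<Longrightarrow> continuous_map Y Z (f x)"
  shows "continuous_map (prod_topology (discrete_topology D) Y) Z (\<lambda>(x, y). f x y)"
  unfolding continuous_map
proof (intro conjI allI impI)
  let ?P = "prod_topology (discrete_topology D) Y"
  show "(\<lambda>(x, y). f x y) ` topspace ?P \<subseteq> topspace Z"
    using assms by (auto simp: continuous_map)
  fix U assume U: "openin Z U"
  have "{p \<in> topspace ?P. (\<lambda>(x, y). f x y) p \<in> U} = (\<Union>x\<in>D. {x} \<times> {y \<in> topspace Y. f x y \<in> U})"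
    by auto
  moreover have "openin ?P ({x} \<times> {y \<in> topspace Y. f x y \<in> U})" if "x \<in> D" for x
    using that openin_continuous_map_preimage[OF assms[OF that] U] by (simp add: openin_prod_Times_iff)
  ultimately show "openin ?P {p \<in> topspace ?P. (\<lambda>(x, y). f x y) p \<in> U}"
    by (simp only:) (rule openin_Union, blast)
qed

lemma Hausdorff_space_function_space: "Hausdorff_space (euclidean :: ('a \<Rightarrow> real) topology)"
  unfolding euclidean_product_topology[symmetric] Hausdorff_space_product_topology by simp

context skeletal_endofree_category
begin

lemma continuous_place: "continuous_map (presentation_space (nerve C)) euclidean place"
  unfolding presentation_space_def
proof (rule continuous_map_from_sum_topology)
  fix n :: nat
  let ?Y = "subtopology (powertop_real UNIV) (standard_simplex n)"
  have "continuous_map ?Y euclidean (\<lambda>t. point (arrows n x) (mass n (fst x) t))" for x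
  proof -
    have c: "continuous_on (standard_simplex n) (\<lambda>t. t i)" for i
      by (rule continuous_on_product_then_coordinatewise[OF continuous_on_id])
    have "continuous_on (standard_simplex n) (\<lambda>t. point (arrows n x) (mass n (fst x) t) e)" for e
    proof (cases "e \<in> arrows n x")
      case True
      have "continuous_on (standard_simplex n) (\<lambda>t. mass n (fst x) t v)" for v
        unfolding mass_def by (intro continuous_on_sum c)
      then have "continuous_on (standard_simplex n) (\<lambda>t. \<Prod>v\<in>arrow_ends e. mass n (fst x) t v)"
        by (rule continuous_on_prod)
      then show ?thesis using True by (simp only: point_def if_True)
    next
      case False
      then show ?thesis by (simp only: point_def if_False continuous_on_const)
    qed
    then have "continuous_on (standard_simplex n) (\<lambda>t. point (arrows n x) (mass n (fst x) t))"
      by (rule continuous_on_coordinatewise_then_product)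
    then show ?thesis unfolding euclidean_product_topology by (simp only: continuous_map_iff_continuous)
  qed
  then have "continuous_map (prod_topology (discrete_topology (Simp (nerve C) n)) ?Y) euclidean
      (\<lambda>(x, t). point (arrows n x) (mass n (fst x) t))"
    by (intro continuous_map_from_discrete_prod)
  moreover have "(\<lambda>(x, t). point (arrows n x) (mass n (fst x) t)) = (\<lambda>xt. place (n, xt))"
    by (auto simp: place_def fun_eq_iff)
  ultimately show "continuous_map (prod_topology (discrete_topology (Simp (nerve C) n)) ?Y) euclidean (\<lambda>xt. place (n, xt))"
    by (simp only:)
qed

lemma finite_simplices: "finite (Simp (nerve C) n)"
proof (rule finite_subset)
  let ?I = "{(i, j). i \<le> j \<and> j \<le> n}"
  show "Simp (nerve C) n \<subseteq> ({..n} \<rightarrow>\<^sub>E Obj C) \<times> (?I \<rightarrow>\<^sub>E Mor C)"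
    by (auto simp: nerve_def functors_def ordinal_cat_def)
  have "finite ?I" by (rule finite_subset[of _ "{..n} \<times> {..n}"]) auto
  then show "finite (({..n} \<rightarrow>\<^sub>E Obj C) \<times> (?I \<rightarrow>\<^sub>E Mor C))"
    using finite_C by (intro finite_cartesian_product finite_PiE) (auto simp: finite_cat_def)
qed

lemma nondegenerate_dimension:
  assumes "x \<in> Simp (nerve C) n" "inj_on (fst x) {..n}"
  shows "n < card (Obj C)"
proof -
  obtain F G where FG: "x = (F, G)" by (cases x)
  have "card (F ` {..n}) \<le> card (Obj C)"
    using assms(1) simplex_obj finite_C by (intro card_mono) (auto simp: FG finite_cat_def)
  then show ?thesis using card_image[OF assms(2)] by (simp add: FG)
qed

text \<open>Normal forms have dimension less than the number of objects, so finitely many products of a finite set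
  with a standard simplex already cover the realization.\<close>

lemma compact_realization: "compact_space (realization (nerve C))"
proof -
  let ?P = "presentation_space (nerve C)"
  let ?R = "realization (nerve C)"
  let ?q = "\<lambda>p. gluing_equiv (nerve C) `` {p}"
  let ?K = "\<lambda>n. Pair n ` (Simp (nerve C) n \<times> standard_simplex n)"
  have K: "compactin ?P (?K n)" for n
  proof (rule image_compactin)
    let ?Y = "subtopology (powertop_real UNIV) (standard_simplex n)"
    show "compactin (prod_topology (discrete_topology (Simp (nerve C) n)) ?Y) (Simp (nerve C) n \<times> standard_simplex n)"
      unfolding compactin_Times compactin_subtopology compactin_discrete_topology
      using finite_simplices compactin_standard_simplex by blast
    show "continuous_map (prod_topology (discrete_topology (Simp (nerve C) n)) ?Y) ?P (Pair n)"
      unfolding presentation_space_def by (rule continuous_map_component_injection) simp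
  qed
  have "compactin ?P (\<Union>n\<in>{..<card (Obj C)}. ?K n)"
    by (rule compactin_Union) (use K in auto)
  then have "compactin ?R (?q ` (\<Union>n\<in>{..<card (Obj C)}. ?K n))"
    by (rule image_compactin) (rule quotient_imp_continuous_map[OF quotient_map_realization])
  moreover have "?q ` (\<Union>n\<in>{..<card (Obj C)}. ?K n) = topspace ?R"
  proof
    show "?q ` (\<Union>n\<in>{..<card (Obj C)}. ?K n) \<subseteq> topspace ?R"
      using calculation by (rule compactin_subset_topspace)
    show "topspace ?R \<subseteq> ?q ` (\<Union>n\<in>{..<card (Obj C)}. ?K n)"
    proof
      fix c assume "c \<in> topspace ?R"
      then obtain p where p: "p \<in> topspace ?P" "c = ?q p"
        unfolding topspace_realization by (rule quotientE)
      obtain m y s where mys: "p = (m, y, s)" by (cases p)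
      obtain q where q: "normal_form q" "(p, q) \<in> gluing_equiv (nerve C)"
        using reduce_to_normal_form[of y m s] p(1) unfolding mys topspace_presentation by blast
      obtain n x t where nxt: "q = (n, x, t)" by (cases q)
      have x: "x \<in> Simp (nerve C) n" "t \<in> standard_simplex n" "inj_on (fst x) {..n}"
        using q(1) unfolding nxt normal_form_def by simp_all
      have "q \<in> ?K n" unfolding nxt using x by blast
      moreover have "n \<in> {..<card (Obj C)}" using nondegenerate_dimension[OF x(1,3)] by simp
      moreover have "c = ?q q"
        unfolding p(2) using q(2) by (auto intro: gluing_equiv_trans gluing_equiv_sym)
      ultimately show "c \<in> ?q ` (\<Union>n\<in>{..<card (Obj C)}. ?K n)" by blast
    qed
  qed
  ultimately show ?thesis by (simp add: compact_space_def)
qed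

text \<open>\<^const>\<open>place\<close> descends to a continuous bijection from a compact space to a Hausdorff space.\<close>

theorem realization_homeomorphic_polyhedron:
  "realization (nerve C) homeomorphic_space top_of_set (polyhedron nerve_cells)"
proof -
  let ?P = "presentation_space (nerve C)"
  let ?R = "realization (nerve C)"
  let ?q = "\<lambda>p. gluing_equiv (nerve C) `` {p}"
  let ?X = "top_of_set (polyhedron nerve_cells)"
  define lift where "lift c = place (SOME p. p \<in> c)" for c
  have lift: "lift (?q p) = place p" for p
  proof -
    have "p \<in> ?q p" by (simp add: gluing_equiv_def)
    then have "(SOME q. q \<in> ?q p) \<in> ?q p" by (rule someI)
    then have "(p, SOME q. q \<in> ?q p) \<in> gluing_equiv (nerve C)" by (simp only: Image_singleton_iff)
    from place_gluing_equiv[OF this] show ?thesis unfolding lift_def by (rule sym)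
  qed
  have "homeomorphic_map ?R ?X lift"
  proof (rule continuous_imp_homeomorphic_map)
    have "continuous_map ?P ?X place"
      using continuous_place place_image by (simp add: continuous_map_in_subtopology image_subset_iff_funcset[symmetric])
    moreover have "lift \<circ> ?q = place" using lift by (simp add: fun_eq_iff)
    ultimately have "continuous_map ?P ?X (lift \<circ> ?q)" by (simp only:)
    with quotient_map_realization show "continuous_map ?R ?X lift"
      by (rule continuous_compose_quotient_map)
    show "compact_space ?R" by (rule compact_realization)
    show "Hausdorff_space ?X"
      by (rule Hausdorff_space_subtopology[OF Hausdorff_space_function_space])
    have "lift ` topspace ?R = lift ` ?q ` topspace ?P"
      unfolding topspace_realization quotient_def by (rule arg_cong[where f = "image lift"]) blast
    also have "\<dots> = place ` topspace ?P" unfolding image_image lift ..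
    also have "\<dots> = topspace ?X" by (simp only: place_image topspace_euclidean_subtopology)
    finally show "lift ` topspace ?R = topspace ?X" .
    show "inj_on lift (topspace ?R)"
    proof (rule inj_onI)
      fix c d assume "c \<in> topspace ?R" "d \<in> topspace ?R" and eq: "lift c = lift d"
      then obtain p r where p: "p \<in> topspace ?P" "c = ?q p" and r: "r \<in> topspace ?P" "d = ?q r"
        unfolding topspace_realization by (meson quotientE)
      have "(p, r) \<in> gluing_equiv (nerve C)"
        using eq by (intro place_inj[OF p(1) r(1)]) (simp only: p r lift)
      then show "c = d"
        unfolding p(2) r(2) by (auto intro: gluing_equiv_trans gluing_equiv_sym)
    qed
  qed
  then show ?thesis by (rule homeomorphic_map_imp_homeomorphic_space)
qed

definition nondegenerate_simplices :: "nat \<Rightarrow> ((nat \<Rightarrow> 'o) \<times> (nat \<times> nat \<Rightarrow> 'm)) set" where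
  "nondegenerate_simplices n = {x \<in> Simp (nerve C) n. inj_on (fst x) {..n}}"

lemma nerve_cells_nondegenerate:
  "nerve_cells = (\<Union>n<card (Obj C). arrows n ` nondegenerate_simplices n)"
proof
  show "(\<Union>n<card (Obj C). arrows n ` nondegenerate_simplices n) \<subseteq> nerve_cells"
    by (auto simp: nerve_cells_def nondegenerate_simplices_def)
  show "nerve_cells \<subseteq> (\<Union>n<card (Obj C). arrows n ` nondegenerate_simplices n)"
  proof
    fix M assume "M \<in> nerve_cells"
    then obtain n x where M: "M = arrows n x" and x: "x \<in> Simp (nerve C) n"
      unfolding nerve_cells_def by blast
    \<comment> \<open>The barycenter has full support, so its normal form has the same cell as \<open>x\<close>.\<close>
    define t where "t i = (if i \<le> n then 1 / real (Suc n) else 0)" for i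
    have t: "t \<in> standard_simplex n" by (auto simp: standard_simplex_def t_def)
    have "mass n (fst x) t (fst x i) \<noteq> 0" if "i \<le> n" for i
    proof -
      have "0 < mass n (fst x) t (fst x i)"
        unfolding mass_def by (rule sum_pos2[of _ i]) (use that in \<open>auto simp: t_def\<close>)
      then show ?thesis by simp
    qed
    then have s: "support (place (n, x, t)) = M" unfolding M by (rule support_place[OF x])
    obtain q where q: "normal_form q" "((n, x, t), q) \<in> gluing_equiv (nerve C)"
      using reduce_to_normal_form[OF x t] by blast
    obtain k y u where kyu: "q = (k, y, u)" by (cases q)
    have y: "y \<in> Simp (nerve C) k" "inj_on (fst y) {..k}"
      using q(1) unfolding kyu normal_form_def by simp_all
    have "M = arrows k y"
      using support_normal_form[OF q(1)[unfolded kyu]] place_gluing_equiv[OF q(2)] s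
      unfolding kyu by (simp only:)
    moreover have "y \<in> nondegenerate_simplices k" using y by (simp add: nondegenerate_simplices_def)
    moreover have "k < card (Obj C)" by (rule nondegenerate_dimension[OF y])
    ultimately show "M \<in> (\<Union>n<card (Obj C). arrows n ` nondegenerate_simplices n)" by blast
  qed
qed

lemma card_verts_nondegenerate:
  assumes "x \<in> nondegenerate_simplices n"
  shows "card (verts (arrows n x)) = Suc n"
proof -
  obtain F G where FG: "x = (F, G)" by (cases x)
  have "verts (arrows n x) = F ` {..n}" "inj_on F {..n}"
    using assms verts_arrows by (simp_all add: FG nondegenerate_simplices_def)
  then show ?thesis by (simp add: card_image)
qed

theorem euler_characteristic_realization:
  "euler_characteristic (realization (nerve C)) =
    (\<Sum>n<card (Obj C). (-1) ^ n * int (card (nondegenerate_simplices n)))"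
proof -
  let ?w = "\<lambda>M. (-1) ^ (card (verts M) + 1) :: int"
  have fin: "finite (nondegenerate_simplices n)" for n
    using finite_simplices by (simp add: nondegenerate_simplices_def)
  have inj: "inj_on (arrows n) (nondegenerate_simplices n)" for n
    by (rule inj_onI, rule nondegenerate_determined_by_arrows[THEN conjunct2])
      (simp_all add: nondegenerate_simplices_def)
  have "has_euler (realization (nerve C)) (sum ?w nerve_cells)"
    by (rule has_euler_homotopy_equivalent[OF homeomorphic_imp_homotopy_equivalent_space
          [OF realization_homeomorphic_polyhedron] has_euler_polyhedron[OF cell_complex_nerve_cells]])
  then have "euler_characteristic (realization (nerve C)) = sum ?w nerve_cells"
    by (rule euler_characteristic_eq)
  also have "\<dots> = (\<Sum>n<card (Obj C). sum ?w (arrows n ` nondegenerate_simplices n))"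
    unfolding nerve_cells_nondegenerate
  proof (rule sum.UNION_disjoint)
    have "arrows n x \<noteq> arrows m y"
      if "n \<noteq> m" "x \<in> nondegenerate_simplices n" "y \<in> nondegenerate_simplices m" for n m x y
    proof
      assume "arrows n x = arrows m y"
      then have "Suc n = Suc m"
        using card_verts_nondegenerate[OF that(2)] card_verts_nondegenerate[OF that(3)] by simp
      then show False using that(1) by simp
    qed
    then show "\<forall>n\<in>{..<card (Obj C)}. \<forall>m\<in>{..<card (Obj C)}. n \<noteq> m \<longrightarrow>
        arrows n ` nondegenerate_simplices n \<inter> arrows m ` nondegenerate_simplices m = {}"
      by blast
  qed (use fin in auto)
  also have "\<dots> = (\<Sum>n<card (Obj C). (-1) ^ n * int (card (nondegenerate_simplices n)))"
  proof (rule sum.cong)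
    fix n
    have "sum ?w (arrows n ` nondegenerate_simplices n) =
        (\<Sum>x\<in>nondegenerate_simplices n. (-1) ^ n)"
      using inj[of n] card_verts_nondegenerate by (simp add: sum.reindex)
    then show "sum ?w (arrows n ` nondegenerate_simplices n) =
        (-1) ^ n * int (card (nondegenerate_simplices n))"
      by (simp add: mult.commute)
  qed simp
  finally show ?thesis .
qed

end

section \<open>Counting cells in the directed graph\<close>

text \<open>\<open>F\<close> lists the \<open>n + 1\<close> vertices and \<open>P\<close> the \<open>n\<close> arcs. The arcs determine the vertices unless \<open>n = 0\<close>,
  where the walk is a single vertex.\<close>

definition loopless_walks :: "nat \<Rightarrow> ('v, 'a) pre_digraph \<Rightarrow> ((nat \<Rightarrow> 'v) \<times> (nat \<Rightarrow> 'a)) set" where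
  "loopless_walks n D = {(F, P). F \<in> {..n} \<rightarrow>\<^sub>E pre_digraph.verts D \<and> P \<in> {..<n} \<rightarrow>\<^sub>E arcs D \<and>
    (\<forall>i<n. tail D (P i) = F i \<and> head D (P i) = F (Suc i) \<and> F i \<noteq> F (Suc i))}"

lemma loopless_walks_iff:
  "(F, P) \<in> loopless_walks n D \<longleftrightarrow> F \<in> {..n} \<rightarrow>\<^sub>E pre_digraph.verts D \<and> P \<in> {..<n} \<rightarrow>\<^sub>E arcs D \<and>
    (\<forall>i<n. tail D (P i) = F i \<and> head D (P i) = F (Suc i) \<and> F i \<noteq> F (Suc i))"
  by (simp only: loopless_walks_def mem_Collect_eq case_prod_conv)

lemma finite_loopless_walks:
  assumes "finite (pre_digraph.verts D)" "finite (arcs D)"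
  shows "finite (loopless_walks n D)"
proof (rule finite_subset)
  show "loopless_walks n D \<subseteq> ({..n} \<rightarrow>\<^sub>E pre_digraph.verts D) \<times> ({..<n} \<rightarrow>\<^sub>E arcs D)"
    by (auto simp: loopless_walks_def)
  show "finite (({..n} \<rightarrow>\<^sub>E pre_digraph.verts D) \<times> ({..<n} \<rightarrow>\<^sub>E arcs D))"
    using assms by (intro finite_cartesian_product finite_PiE) auto
qed

lemma card_loopless_walks_le:
  assumes "digraph_iso D E" and fin: "finite (loopless_walks n E)"
  shows "card (loopless_walks n D) \<le> card (loopless_walks n E)"
proof -
  obtain h where h: "pre_digraph.digraph_isomorphism D h" and E: "E = app_iso h D"
    using assms(1) unfolding digraph_iso_def by blast
  have inj: "inj_on (iso_verts h) (pre_digraph.verts D)" "inj_on (iso_arcs h) (arcs D)"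
    and ends: "\<And>a. a \<in> arcs D \<Longrightarrow> iso_tail h (iso_arcs h a) = iso_verts h (tail D a)"
      "\<And>a. a \<in> arcs D \<Longrightarrow> iso_head h (iso_arcs h a) = iso_verts h (head D a)"
    using h by (simp_all add: pre_digraph.digraph_isomorphism_def)
  let ?f = "\<lambda>(F, P). (\<lambda>i\<in>{..n}. iso_verts h (F i), \<lambda>i\<in>{..<n}. iso_arcs h (P i))"
  show ?thesis
  proof (rule card_inj_on_le[OF _ _ fin])
    show "inj_on ?f (loopless_walks n D)"
    proof (rule inj_onI)
      fix x y assume x: "x \<in> loopless_walks n D" and y: "y \<in> loopless_walks n D" and eq: "?f x = ?f y"
      obtain F P F' P' where xy: "x = (F, P)" "y = (F', P')" by (cases x, cases y)
      have F: "F \<in> {..n} \<rightarrow>\<^sub>E pre_digraph.verts D" "F' \<in> {..n} \<rightarrow>\<^sub>E pre_digraph.verts D"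
        and P: "P \<in> {..<n} \<rightarrow>\<^sub>E arcs D" "P' \<in> {..<n} \<rightarrow>\<^sub>E arcs D"
        using x y unfolding xy loopless_walks_iff by (simp_all only: simp_thms)
      have e1: "(\<lambda>i\<in>{..n}. iso_verts h (F i)) = (\<lambda>i\<in>{..n}. iso_verts h (F' i))"
        and e2: "(\<lambda>i\<in>{..<n}. iso_arcs h (P i)) = (\<lambda>i\<in>{..<n}. iso_arcs h (P' i))"
        using eq unfolding xy by simp_all
      have "F = F'"
      proof (rule PiE_ext[OF F])
        fix i assume i: "i \<in> {..n}"
        then have "iso_verts h (F i) = iso_verts h (F' i)" using fun_cong[OF e1, of i] by simp
        then show "F i = F' i" by (rule inj_onD[OF inj(1)]) (use i F in auto)
      qed
      moreover have "P = P'"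
      proof (rule PiE_ext[OF P])
        fix i assume i: "i \<in> {..<n}"
        then have "iso_arcs h (P i) = iso_arcs h (P' i)" using fun_cong[OF e2, of i] by simp
        then show "P i = P' i" by (rule inj_onD[OF inj(2)]) (use i P in auto)
      qed
      ultimately show "x = y" by (simp add: xy)
    qed
    show "?f ` loopless_walks n D \<subseteq> loopless_walks n E"
    proof
      fix z assume "z \<in> ?f ` loopless_walks n D"
      then obtain F P where FP: "(F, P) \<in> loopless_walks n D" and z: "z = ?f (F, P)" by (auto simp only:)
      note walk = FP[unfolded loopless_walks_iff]
      have F: "F \<in> {..n} \<rightarrow>\<^sub>E pre_digraph.verts D" and P: "P \<in> {..<n} \<rightarrow>\<^sub>E arcs D"
        by (rule walk[THEN conjunct1], rule walk[THEN conjunct2, THEN conjunct1])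
      have W: "tail D (P i) = F i \<and> head D (P i) = F (Suc i) \<and> F i \<noteq> F (Suc i)" if "i < n" for i
        by (rule walk[THEN conjunct2, THEN conjunct2, rule_format, OF that])
      have Fm: "F i \<in> pre_digraph.verts D" if "i \<le> n" for i using F that by auto
      have Pm: "P i \<in> arcs D" if "i < n" for i using P that by auto
      have "iso_verts h (F i) \<noteq> iso_verts h (F (Suc i))" if "i < n" for i
      proof
        assume "iso_verts h (F i) = iso_verts h (F (Suc i))"
        then have "F i = F (Suc i)"
          by (rule inj_onD[OF inj(1)]) (use that in \<open>simp_all add: Fm\<close>)
        then show False using W[OF that] by blast
      qed
      then have "\<forall>i<n. iso_tail h (iso_arcs h (P i)) = iso_verts h (F i) \<and>
          iso_head h (iso_arcs h (P i)) = iso_verts h (F (Suc i)) \<and>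
          iso_verts h (F i) \<noteq> iso_verts h (F (Suc i))"
        using Pm ends W by simp
      then show "z \<in> loopless_walks n E"
        unfolding z E case_prod_conv loopless_walks_iff app_iso_simps using Fm Pm by (simp add: PiE_iff)
    qed
  qed
qed

lemma card_loopless_walks_iso:
  assumes "digraph_iso D E" "finite (loopless_walks n D)" "finite (loopless_walks n E)"
  shows "card (loopless_walks n D) = card (loopless_walks n E)"
proof (rule le_antisym)
  have "wf_digraph D"
    using assms(1) by (auto simp: digraph_iso_def pre_digraph.digraph_isomorphism_def)
  then show "card (loopless_walks n E) \<le> card (loopless_walks n D)"
    using card_loopless_walks_le[OF digraph_iso_swap[OF _ assms(1)] assms(2)] by blast
qed (rule card_loopless_walks_le[OF assms(1,3)])

context skeletal_endofree_category
begin

text \<open>The composite of the \<open>d\<close> maps of a walk \<open>P\<close> that start at its vertex \<open>i\<close>.\<close>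

fun composite :: "(nat \<Rightarrow> 'o) \<Rightarrow> (nat \<Rightarrow> 'm) \<Rightarrow> nat \<Rightarrow> nat \<Rightarrow> 'm" where
  "composite F P i 0 = Id C (F i)"
| "composite F P i (Suc d) = Comp C (P (i + d)) (composite F P i d)"

context
  fixes F :: "nat \<Rightarrow> 'o" and P :: "nat \<Rightarrow> 'm" and n :: nat
  assumes walk_objects: "\<And>j. j \<le> n \<Longrightarrow> F j \<in> Obj C"
    and walk_arrows: "\<And>j. j < n \<Longrightarrow> P j \<in> Mor C \<and> Dom C (P j) = F j \<and> Cod C (P j) = F (Suc j)"
begin

lemma composite_arrow:
  assumes "i + d \<le> n"
  shows "composite F P i d \<in> Mor C \<and> Dom C (composite F P i d) = F i \<and> Cod C (composite F P i d) = F (i + d)"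
  using assms
proof (induction d)
  case 0
  then show ?case using walk_objects by (simp add: Id_closed Dom_Id Cod_Id)
next
  case (Suc d)
  then show ?case using walk_arrows[of "i + d"] by (simp add: Comp_closed Dom_Comp Cod_Comp)
qed

lemma composite_add:
  assumes "i + d + e \<le> n"
  shows "composite F P i (d + e) = Comp C (composite F P (i + d) e) (composite F P i d)"
  using assms
proof (induction e)
  case 0
  then have "composite F P i d \<in> Mor C" "Cod C (composite F P i d) = F (i + d)"
    using composite_arrow[of i d] by simp_all
  then show ?case using Comp_Id_left[of "composite F P i d"] by simp
next
  case (Suc e)
  note a = composite_arrow[of i d]
    and b = composite_arrow[of "i + d" e]
  have "composite F P i (d + Suc e) =
      Comp C (P (i + d + e)) (Comp C (composite F P (i + d) e) (composite F P i d))"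
    using Suc by (simp add: add.assoc)
  also have "\<dots> = Comp C (Comp C (P (i + d + e)) (composite F P (i + d) e)) (composite F P i d)"
    using a b walk_arrows[of "i + d + e"] Suc.prems by (intro Comp_assoc) simp_all
  finally show ?case by simp
qed

end

text \<open>A simplex of the nerve is determined by its consecutive maps, and any composable maps extend to one
  by composition. If none of them is a loop, then no object recurs, by \<open>repeated_vertex\<close>.\<close>

lemma bij_betw_nondegenerate_walks:
  "bij_betw (\<lambda>(F, G). (F, \<lambda>i\<in>{..<n}. G (i, Suc i))) (nondegenerate_simplices n)
    (loopless_walks n (underlying_digraph C))"
  unfolding bij_betw_def
proof
  let ?f = "\<lambda>(F, G). (F, \<lambda>i\<in>{..<n}. G (i, Suc i))"
  show "inj_on ?f (nondegenerate_simplices n)"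
  proof (rule inj_onI)
    fix x y assume x: "x \<in> nondegenerate_simplices n" and y: "y \<in> nondegenerate_simplices n" and eq: "?f x = ?f y"
    obtain F G F' G' where xy: "x = (F, G)" "y = (F', G')" by (cases x, cases y)
    have x': "(F, G) \<in> Simp (nerve C) n" and y': "(F', G') \<in> Simp (nerve C) n"
      using x y unfolding xy nondegenerate_simplices_def by blast+
    have F: "F = F'" and e: "(\<lambda>i\<in>{..<n}. G (i, Suc i)) = (\<lambda>i\<in>{..<n}. G' (i, Suc i))"
      using eq unfolding xy by simp_all
    have "G (i, i + d) = G' (i, i + d)" if "i + d \<le> n" for i d
      using that
    proof (induction d)
      case 0
      then show ?case using simplex_id[OF x', of i] simplex_id[OF y', of i] F by simp
    next
      case (Suc d)
      then have "G (i + d, Suc (i + d)) = G' (i + d, Suc (i + d))"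
        using fun_cong[OF e, of "i + d"] by simp
      then show ?case
        using Suc simplex_comp[OF x', of i "i + d" "Suc (i + d)"] simplex_comp[OF y', of i "i + d" "Suc (i + d)"]
        by simp
    qed
    note step = this
    have G: "G (i, j) = G' (i, j)" if "i \<le> j" "j \<le> n" for i j
      using step[of i "j - i"] that by simp
    have "G = G'"
      using simplex_ext(2)[OF x'] simplex_ext(2)[OF y'] G
      by (intro extensionalityI[of _ "{(i, j). i \<le> j \<and> j \<le> n}"]) auto
    then show "x = y" using F by (simp add: xy)
  qed
  show "?f ` nondegenerate_simplices n = loopless_walks n (underlying_digraph C)"
  proof
    show "?f ` nondegenerate_simplices n \<subseteq> loopless_walks n (underlying_digraph C)"
    proof
      fix z assume "z \<in> ?f ` nondegenerate_simplices n"
      then obtain F G where z: "z = (F, \<lambda>i\<in>{..<n}. G (i, Suc i))" and x: "(F, G) \<in> Simp (nerve C) n"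
        and inj: "inj_on F {..n}"
        unfolding nondegenerate_simplices_def by auto
      have "F i \<noteq> F (Suc i)" if "i < n" for i
        using inj_onD[OF inj, of i "Suc i"] that by auto
      then show "z \<in> loopless_walks n (underlying_digraph C)"
        using simplex_ext(1)[OF x] simplex_obj[OF x]
        by (simp add: z loopless_walks_def underlying_digraph_def PiE_iff
            simplex_arrow[OF x] simplex_dom[OF x] simplex_cod[OF x])
    qed
    show "loopless_walks n (underlying_digraph C) \<subseteq> ?f ` nondegenerate_simplices n"
    proof
      fix z assume "z \<in> loopless_walks n (underlying_digraph C)"
      then obtain F P where z: "z = (F, P)" and F: "F \<in> {..n} \<rightarrow>\<^sub>E Obj C" and P: "P \<in> {..<n} \<rightarrow>\<^sub>E Mor C"
        and W: "\<And>i. i < n \<Longrightarrow> Dom C (P i) = F i \<and> Cod C (P i) = F (Suc i) \<and> F i \<noteq> F (Suc i)"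
      proof (cases z)
        case (Pair F P)
        with that \<open>z \<in> loopless_walks n (underlying_digraph C)\<close> show thesis
          by (simp add: loopless_walks_iff underlying_digraph_def)
      qed
      have o: "\<And>j. j \<le> n \<Longrightarrow> F j \<in> Obj C" using F by auto
      have m: "\<And>j. j < n \<Longrightarrow> P j \<in> Mor C \<and> Dom C (P j) = F j \<and> Cod C (P j) = F (Suc j)"
        using P W by auto
      let ?I = "{(i, j). i \<le> j \<and> j \<le> n}"
      define G where "G = (\<lambda>(i, j)\<in>?I. composite F P i (j - i))"
      have G: "G (i, j) = composite F P i (j - i)" if "i \<le> j" "j \<le> n" for i j
        using that by (simp add: G_def)
      note ca = composite_arrow[where n = n and F = F and P = P, OF o m]
      have x: "(F, G) \<in> Simp (nerve C) n"
        unfolding nerve_simplex_iff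
      proof (intro conjI ballI allI impI; (elim conjE)?)
        show "F \<in> extensional {..n}" using F by (simp add: PiE_iff)
        show "G \<in> extensional ?I" unfolding G_def by (rule restrict_extensional)
        fix i j assume ij: "i \<le> j" "j \<le> n"
        show "G (i, j) \<in> Mor C" "Dom C (G (i, j)) = F i" "Cod C (G (i, j)) = F j"
          using ca[of i "j - i"] ij by (simp_all add: G)
        fix k assume jk: "j \<le> k" "k \<le> n"
        have "composite F P i (j - i + (k - j)) =
            Comp C (composite F P (i + (j - i)) (k - j)) (composite F P i (j - i))"
          using ij jk by (intro composite_add[where n = n and F = F and P = P, OF o m]) simp_all
        then show "G (i, k) = Comp C (G (j, k)) (G (i, j))"
          using ij jk by (simp add: G)
      next
        fix i assume i: "i \<in> {..n}"
        then show "F i \<in> Obj C" using o by simp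
        show "G (i, i) = Id C (F i)" using i by (simp add: G)
      qed
      have "inj_on F {..n}"
      proof (rule ccontr)
        assume "\<not> inj_on F {..n}"
        then obtain i where "Suc i \<le> n" "F i = F (Suc i)" by (rule repeated_vertex[OF x])
        then show False using W[of i] by simp
      qed
      then have "(F, G) \<in> nondegenerate_simplices n" using x by (simp add: nondegenerate_simplices_def)
      moreover have "(\<lambda>i\<in>{..<n}. G (i, Suc i)) = P"
      proof (rule extensionalityI[of _ "{..<n}"])
        show "P \<in> extensional {..<n}" using P by (simp add: PiE_iff)
        fix i assume "i \<in> {..<n}"
        then show "(\<lambda>i\<in>{..<n}. G (i, Suc i)) i = P i"
          using m[of i] Comp_Id_right[of "P i"] by (simp add: G)
      qed simp
      ultimately show "z \<in> ?f ` nondegenerate_simplices n"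
        unfolding z by (intro image_eqI[of _ _ "(F, G)"]) simp_all
    qed
  qed
qed

text \<open>The composition of \<open>C\<close> no longer occurs on the right-hand side.\<close>

theorem euler_characteristic_loopless_walks:
  "euler_characteristic (realization (nerve C)) =
    (\<Sum>n<card (pre_digraph.verts (underlying_digraph C)).
      (-1) ^ n * int (card (loopless_walks n (underlying_digraph C))))"
  unfolding euler_characteristic_realization
  using bij_betw_same_card[OF bij_betw_nondegenerate_walks] by (simp add: underlying_digraph_def)

end

theorem proposition1p5:
  fixes A :: "('o, 'm) cat" and A' :: "('p, 'q) cat"
  assumes "category A" and "category A'"
    and "finite_cat A" and "finite_cat A'"
    and "skeletal A" and "skeletal A'"
    and "no_nontrivial_endomorphisms A" and "no_nontrivial_endomorphisms A'"
    and "digraph_iso (underlying_digraph A) (underlying_digraph A')"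
  shows "euler_characteristic (realization (nerve A)) =
         euler_characteristic (realization (nerve A'))"
proof -
  interpret A: skeletal_endofree_category A
    using assms by (simp add: skeletal_endofree_category_def skeletal_endofree_category_axioms_def)
  interpret A': skeletal_endofree_category A'
    using assms by (simp add: skeletal_endofree_category_def skeletal_endofree_category_axioms_def)
  let ?D = "underlying_digraph A" and ?D' = "underlying_digraph A'"
  have "finite (loopless_walks n ?D)" "finite (loopless_walks n ?D')" for n
    using assms(3,4) by (auto intro!: finite_loopless_walks simp: finite_cat_def underlying_digraph_def)
  then have walks: "card (loopless_walks n ?D) = card (loopless_walks n ?D')" for n
    by (intro card_loopless_walks_iso[OF assms(9)])
  obtain h where "pre_digraph.digraph_isomorphism ?D h" "?D' = app_iso h ?D"
    using assms(9) unfolding digraph_iso_def by blast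
  then have "card (pre_digraph.verts ?D') = card (pre_digraph.verts ?D)"
    by (simp add: pre_digraph.digraph_isomorphism_def card_image)
  with walks show ?thesis
    unfolding A.euler_characteristic_loopless_walks A'.euler_characteristic_loopless_walks by simp
qed

end
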